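(* Let $z_1,z_2\in\mathbb P$ with $z_2\neq z_1$, let $\mathtt v\in\mathbf W^{z_1}$, and set $$S(z_1)=e^3(z_1)+3e^2(z_1)i(z_1)+3e(z_1)i^2(z_1)+i^3(z_1):\mathbf W^{z_1}\to\mathbf W\otimes K_{z_1}^3 .$$ Then, as $z_2\to z_1$, $$\bigl[2\,b(z_2)T(z_1)-2\,\omega(z_2,z_1)\,b(z_1)\bigr]\mathtt v\ \longrightarrow\ S(z_1)\,\mathtt v ,$$ that is, an element of $\mathbf W\otimes K_{z_2}\otimes K_{z_1}^2$ tends to an element of $\mathbf W\otimes K_{z_1}^3$.
   Context: $\mathbb P$ is a complex projective line; $K$ its canonical bundle, $K_z$ the fibre at $z$. A coordinate is a meromorphic function $u$ on $\mathbb P$ with exactly one pole, which is simple; $du_z\in K_z$ is the value of $du$ at $z$ (for $z$ not the pole). $\mathbf K$ is the space of meromorphic 1-forms on $\mathbb P$ of the second kind (all residues zero), $\mathbf K^z\subset\mathbf K$ the subspace of forms regular at $z$; $\mathbf W=S^*\mathbf K$ and $\mathbf W^z=S^*\mathbf K^z$ are the (algebraic) symmetric algebras, with vacuum $\mathbf 1=1\in\mathbb C$. Fields: $e(z):\mathbf W\to\mathbf W\otimes K_z$ is multiplication by $e_z=-\frac{du}{(u-u(z))^2}\otimes du_z$ ($u$ any coordinate regular at $z$; $e_z$ is independent of $u$). $i(z):\mathbf W^z\to\mathbf W^z\otimes K_z$ is the derivation with $i(z)\mathbf 1=0$ and $i(z)\alpha=-\alpha(z)$ for $\alpha\in\mathbf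 K^z$. $b(z)=i(z)+e(z):\mathbf W^z\to\mathbf W\otimes K_z$. The energy-momentum tensor is $T(z)=\tfrac12\{i(z)\circ i(z)+e(z)\circ e(z)+2e(z)\circ i(z)\}:\mathbf W^z\to\mathbf W\otimes K_z^2$. In all products powers of $e$ are written to the left of powers of $i$. $\omega(z_2,z_1)=\frac{1}{(u(z_2)-u(z_1))^2}\,du_{z_2}\otimes^s du_{z_1}$, where tensor factors $K_{z_1},K_{z_2}$ are exchanged without signs; $\omega$ does not depend on the coordinate. Limits: for $\mathtt v\in\mathbf W^{z_1}$ the expressions are defined for $z_2\ne z_1$ in a Zariski neighbourhood of $z_1$ (depending on $\mathtt v$). After trivialising $K$ by $du$ near $z_1$, the degree $m$ component of the expression is a symmetric polydifferential in $m$ auxiliary points depending rationally on those points and on $u(z_2)$; the limit statement means that each component has no pole along $z_2=z_1$ and that its restriction to $z_2=z_1$ is the corresponding component of the right side. *)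

theory Defs
  imports "HOL-Complex_Analysis.Complex_Analysis" "HOL-Library.Multiset"
    "HOL-Library.Poly_Mapping" "HOL-Combinatorics.Permutations"
begin

section \<open>The projective line, its coordinates, meromorphic 1-forms\<close>

text \<open>The projective line is the Riemann sphere with its two affine charts. The point \<open>z\<close> has
  coordinate \<open>chart_pt z\<close> in the chart \<open>chart z\<close>.\<close>

datatype pline = Aff complex | Infty

fun chart :: "pline \<Rightarrow> complex \<Rightarrow> pline" where
  "chart (Aff a) w = Aff w"
| "chart Infty w = (if w = 0 then Infty else Aff (1 / w))"

fun chart_pt :: "pline \<Rightarrow> complex" where
  "chart_pt (Aff a) = a"
| "chart_pt Infty = 0"

text \<open>As always with \<open>nicely_meromorphic_on\<close>, the value of a meromorphic function at a pole is
  the irrelevant \<open>0\<close>, and removable singularities are removed.\<close>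

definition mero_fun :: "(pline \<Rightarrow> complex) \<Rightarrow> bool" where
  "mero_fun f \<longleftrightarrow> (\<forall>z. (f \<circ> chart z) nicely_meromorphic_on {chart_pt z})"

definition pole_at :: "(pline \<Rightarrow> complex) \<Rightarrow> pline \<Rightarrow> bool" where
  "pole_at f z \<longleftrightarrow> is_pole (f \<circ> chart z) (chart_pt z)"

definition coordinate :: "(pline \<Rightarrow> complex) \<Rightarrow> bool" where
  "coordinate u \<longleftrightarrow> mero_fun u \<and> (\<exists>!p. pole_at u p) \<and>
     (\<forall>p. pole_at u p \<longrightarrow> zorder (u \<circ> chart p) (chart_pt p) = -1)"

text \<open>The fibre at \<open>z\<close> of the canonical bundle (and of its powers) is identified with the
  complex numbers by means of the differential of the chart \<open>chart z\<close> at \<open>z\<close>. In particular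
  \<open>du u z\<close> is the value at \<open>z\<close> of the differential of \<open>u\<close>; it is meaningful when \<open>z\<close> is not the
  pole of \<open>u\<close>.\<close>

definition du :: "(pline \<Rightarrow> complex) \<Rightarrow> pline \<Rightarrow> complex" where
  "du u z = deriv (u \<circ> chart z) (chart_pt z)"

text \<open>With the same identification a 1-form is a function \<open>\<alpha>\<close> on the projective line, and
  \<open>in_chart \<alpha> z\<close> is its coefficient in the chart \<open>chart z\<close>; in the chart \<open>s = 1/t\<close> at infinity,
  \<open>dt = - ds / s\<^sup>2\<close>.\<close>

fun in_chart :: "(pline \<Rightarrow> complex) \<Rightarrow> pline \<Rightarrow> complex \<Rightarrow> complex" where
  "in_chart \<alpha> (Aff a) w = \<alpha> (Aff w)"
| "in_chart \<alpha> Infty w = (if w = 0 then \<alpha> Infty else - \<alpha> (Aff (1 / w)) / w\<^sup>2)"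

definition mero_form :: "(pline \<Rightarrow> complex) \<Rightarrow> bool" where
  "mero_form \<alpha> \<longleftrightarrow> (\<forall>z. in_chart \<alpha> z nicely_meromorphic_on {chart_pt z})"

typedef form2 = "{\<alpha>. mero_form \<alpha> \<and> (\<forall>z. residue (in_chart \<alpha> z) (chart_pt z) = 0)}"
  morphisms form_val Abs_form2
proof -
  have "in_chart (\<lambda>_. 0) z = (\<lambda>_. 0)" for z
    by (cases z) (auto simp: fun_eq_iff)
  then show ?thesis
    by (intro exI[of _ "\<lambda>_. 0"])
       (auto simp: mero_form_def residue_const intro!: analytic_on_imp_nicely_meromorphic_on)
qed

definition form_regular :: "form2 \<Rightarrow> pline \<Rightarrow> bool" where
  "form_regular \<alpha> z \<longleftrightarrow> \<not> is_pole (in_chart (form_val \<alpha>) z) (chart_pt z)"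

text \<open>The vector space structure: linear combinations are taken pointwise away from poles.\<close>

definition is_lincomb :: "form2 \<Rightarrow> complex \<Rightarrow> form2 \<Rightarrow> complex \<Rightarrow> form2 \<Rightarrow> bool" where
  "is_lincomb \<gamma> a \<alpha> b \<beta> \<longleftrightarrow>
     (\<forall>z. form_regular \<alpha> z \<longrightarrow> form_regular \<beta> z \<longrightarrow>
        form_val \<gamma> z = a * form_val \<alpha> z + b * form_val \<beta> z)"


section \<open>The symmetric algebra\<close>

text \<open>The symmetric algebra of \<open>form2\<close> is the polynomial algebra on symbols for its elements
  modulo the ideal generated by the linear relations. The span with respect to the
  multiplication as scalar action is the generated ideal.\<close>

type_synonym free_alg = "form2 multiset \<Rightarrow>\<^sub>0 complex"

definition fgen :: "form2 \<Rightarrow> free_alg" where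
  "fgen \<alpha> = Poly_Mapping.single {#\<alpha>#} 1"

definition fcst :: "complex \<Rightarrow> free_alg" where
  "fcst c = Poly_Mapping.single {#} c"

definition lin_ideal :: "free_alg set" where
  "lin_ideal = module.span (*)
     {fgen \<gamma> - fcst a * fgen \<alpha> - fcst b * fgen \<beta> | \<gamma> a \<alpha> b \<beta>. is_lincomb \<gamma> a \<alpha> b \<beta>}"

interpretation free_alg: module "(*) :: free_alg \<Rightarrow> free_alg \<Rightarrow> free_alg"
  by unfold_locales (simp_all add: algebra_simps)

lemma lin_ideal_zero: "0 \<in> lin_ideal"
  and lin_ideal_add: "p \<in> lin_ideal \<Longrightarrow> q \<in> lin_ideal \<Longrightarrow> p + q \<in> lin_ideal"
  and lin_ideal_neg: "p \<in> lin_ideal \<Longrightarrow> - p \<in> lin_ideal"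
  and lin_ideal_mult: "p \<in> lin_ideal \<Longrightarrow> r * p \<in> lin_ideal"
  unfolding lin_ideal_def
  by (fact free_alg.span_zero free_alg.span_add free_alg.span_neg free_alg.span_scale)+

lemma lookup_mult_empty:
  fixes p q :: "free_alg"
  shows "Poly_Mapping.lookup (p * q) {#} = Poly_Mapping.lookup p {#} * Poly_Mapping.lookup q {#}"
proof -
  have "(\<Sum>r. Poly_Mapping.lookup q r when {#} = l + r) = (Poly_Mapping.lookup q {#} when l = {#})" for l
  proof (cases "l = {#}")
    case True
    then have "(\<Sum>r. Poly_Mapping.lookup q r when {#} = l + r) = (\<Sum>r. Poly_Mapping.lookup q r when {#} = r)"
      by simp
    then show ?thesis using True by simp
  next
    case False
    then show ?thesis by simp
  qed
  then have "Poly_Mapping.lookup (p * q) {#} =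
      (\<Sum>l. Poly_Mapping.lookup p l * Poly_Mapping.lookup q {#} when l = {#})"
    unfolding lookup_mult by (simp only: mult_when)
  then show ?thesis by (simp only: Sum_any_when_equal)
qed
lemma lookup_lin_ideal_empty:
  assumes "p \<in> lin_ideal"
  shows "Poly_Mapping.lookup p {#} = 0"
proof -
  let ?J = "{p :: free_alg. Poly_Mapping.lookup p {#} = 0}"
  have gen: "Poly_Mapping.lookup (fgen \<alpha>) {#} = 0" for \<alpha>
    by (simp add: fgen_def lookup_single)
  have "lin_ideal \<subseteq> ?J"
    unfolding lin_ideal_def
  proof (rule free_alg.span_minimal)
    show "{fgen \<gamma> - fcst a * fgen \<alpha> - fcst b * fgen \<beta> | \<gamma> a \<alpha> b \<beta>. is_lincomb \<gamma> a \<alpha> b \<beta>} \<subseteq> ?J"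
      by (auto simp: lookup_minus lookup_mult_empty gen)
    show "free_alg.subspace ?J"
      unfolding free_alg.subspace_def by (simp add: lookup_add lookup_mult_empty)
  qed
  with assms show ?thesis by blast
qed

quotient_type W = free_alg / "\<lambda>p q. p - q \<in> lin_ideal"
proof (rule equivpI)
  show "reflp (\<lambda>p q. p - q \<in> lin_ideal)"
    by (simp add: reflp_def lin_ideal_zero)
  show "symp (\<lambda>p q. p - q \<in> lin_ideal)"
  proof (rule sympI)
    fix p q assume "p - q \<in> lin_ideal"
    from lin_ideal_neg[OF this] show "q - p \<in> lin_ideal" by simp
  qed
  show "transp (\<lambda>p q. p - q \<in> lin_ideal)"
  proof (rule transpI)
    fix p q r assume "p - q \<in> lin_ideal" "q - r \<in> lin_ideal"
    from lin_ideal_add[OF this] show "p - r \<in> lin_ideal" by simp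
  qed
qed

instantiation W :: comm_ring_1
begin

lift_definition zero_W :: W is 0 .
lift_definition one_W :: W is 1 .

lift_definition plus_W :: "W \<Rightarrow> W \<Rightarrow> W" is "(+)"
  by (drule (1) lin_ideal_add) (simp add: algebra_simps)

lift_definition uminus_W :: "W \<Rightarrow> W" is uminus
  by (drule lin_ideal_neg) simp

lift_definition minus_W :: "W \<Rightarrow> W \<Rightarrow> W" is "(-)"
proof -
  fix p p' q q' :: free_alg
  assume "p - p' \<in> lin_ideal" "q - q' \<in> lin_ideal"
  then have "(p - p') + - (q - q') \<in> lin_ideal"
    by (intro lin_ideal_add lin_ideal_neg)
  then show "p - q - (p' - q') \<in> lin_ideal"
    by (simp add: algebra_simps)
qed

lift_definition times_W :: "W \<Rightarrow> W \<Rightarrow> W" is "(*)"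
proof -
  fix p p' q q' :: free_alg
  assume "p - p' \<in> lin_ideal" "q - q' \<in> lin_ideal"
  then have "q * (p - p') + p' * (q - q') \<in> lin_ideal"
    by (intro lin_ideal_add lin_ideal_mult)
  then show "p * q - p' * q' \<in> lin_ideal"
    by (simp add: algebra_simps)
qed

instance
proof
  have eqI: "p - q \<in> lin_ideal" if "p = q" for p q :: free_alg
    using that lin_ideal_zero by simp
  fix a b c :: W
  show "a + b + c = a + (b + c)" by transfer (rule eqI, rule add.assoc)
  show "a + b = b + a" by transfer (rule eqI, rule add.commute)
  show "0 + a = a" by transfer (rule eqI, rule add_0_left)
  show "- a + a = 0" by transfer (rule eqI, rule left_minus)
  show "a - b = a + - b" by transfer (rule eqI, rule diff_conv_add_uminus)
  show "a * b * c = a * (b * c)" by transfer (rule eqI, rule mult.assoc)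
  show "a * b = b * a" by transfer (rule eqI, rule mult.commute)
  show "1 * a = a" by transfer (rule eqI, rule mult_1_left)
  show "(a + b) * c = a * c + b * c" by transfer (rule eqI, rule distrib_right)
  have "(0 - 1 :: free_alg) \<notin> lin_ideal"
  proof
    assume "(0 - 1 :: free_alg) \<in> lin_ideal"
    then have "Poly_Mapping.lookup (0 - 1 :: free_alg) {#} = 0"
      by (rule lookup_lin_ideal_empty)
    then show False by (simp add: lookup_minus lookup_one)
  qed
  then show "(0 :: W) \<noteq> 1" by transfer
qed

end

definition iota :: "form2 \<Rightarrow> W" where
  "iota \<alpha> = abs_W (fgen \<alpha>)"

definition cst :: "complex \<Rightarrow> W" where
  "cst c = abs_W (fcst c)"

text \<open>The symmetric algebra of the space of forms regular at \<open>z\<close>, as a subalgebra of \<open>W\<close>.\<close>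

inductive_set W_at :: "pline \<Rightarrow> W set" for z :: pline where
  cst: "cst c \<in> W_at z"
| iota: "form_regular \<alpha> z \<Longrightarrow> iota \<alpha> \<in> W_at z"
| add: "x \<in> W_at z \<Longrightarrow> y \<in> W_at z \<Longrightarrow> x + y \<in> W_at z"
| mult: "x \<in> W_at z \<Longrightarrow> y \<in> W_at z \<Longrightarrow> x * y \<in> W_at z"


section \<open>Fields\<close>

text \<open>Fields with values in \<open>W\<close> tensored with a power of the fibre of the canonical bundle at
  \<open>z\<close> become \<open>W\<close>-valued by the identification of this fibre with the complex numbers.\<close>

definition e_form :: "pline \<Rightarrow> form2" where
  "e_form z = (THE \<gamma>. \<forall>u. coordinate u \<longrightarrow> \<not> pole_at u z \<longrightarrow>
     (\<forall>x. x \<noteq> z \<longrightarrow> \<not> pole_at u x \<longrightarrow>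
        form_val \<gamma> x = - du u x / (u x - u z)\<^sup>2 * du u z))"

definition e_field :: "pline \<Rightarrow> W \<Rightarrow> W" where
  "e_field z w = iota (e_form z) * w"

text \<open>Outside its domain \<open>W_at z\<close> the operator \<open>i_field z\<close> is set to \<open>0\<close>.\<close>

definition i_field :: "pline \<Rightarrow> W \<Rightarrow> W" where
  "i_field z = (THE D.
     (\<forall>x\<in>W_at z. \<forall>y\<in>W_at z. D (x + y) = D x + D y) \<and>
     (\<forall>c. \<forall>x\<in>W_at z. D (cst c * x) = cst c * D x) \<and>
     (\<forall>x\<in>W_at z. \<forall>y\<in>W_at z. D (x * y) = D x * y + x * D y) \<and>
     D 1 = 0 \<and>
     (\<forall>\<alpha>. form_regular \<alpha> z \<longrightarrow> D (iota \<alpha>) = cst (- form_val \<alpha> z)) \<and>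
     (\<forall>x. x \<notin> W_at z \<longrightarrow> D x = 0))"

definition b_field :: "pline \<Rightarrow> W \<Rightarrow> W" where
  "b_field z w = i_field z w + e_field z w"

definition T_field :: "pline \<Rightarrow> W \<Rightarrow> W" where
  "T_field z w = cst (1 / 2) *
     (i_field z (i_field z w) + e_field z (e_field z w) + 2 * e_field z (i_field z w))"

definition S_field :: "pline \<Rightarrow> W \<Rightarrow> W" where
  "S_field z w =
     e_field z (e_field z (e_field z w)) + 3 * e_field z (e_field z (i_field z w))
     + 3 * e_field z (i_field z (i_field z w)) + i_field z (i_field z (i_field z w))"

definition omega :: "pline \<Rightarrow> pline \<Rightarrow> complex" where
  "omega z2 z1 = (THE c. \<forall>u. coordinate u \<longrightarrow> \<not> pole_at u z1 \<longrightarrow> \<not> pole_at u z2 \<longrightarrow>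
     c = 1 / (u z2 - u z1)\<^sup>2 * du u z2 * du u z1)"


section \<open>Limits\<close>

text \<open>The symmetric product of \<open>m\<close> forms as a symmetric polydifferential in \<open>m\<close> points.\<close>

definition sym_polydiff :: "form2 list \<Rightarrow> (nat \<Rightarrow> pline) \<Rightarrow> complex" where
  "sym_polydiff L p = (\<Sum>\<sigma> | \<sigma> permutes {..<length L}. \<Prod>i<length L. form_val (L ! \<sigma> i) (p i))"

text \<open>\<open>\<Phi>\<close> is the degree \<open>m\<close> component of \<open>w\<close>, seen as a symmetric polydifferential. It does not
  depend on the way \<open>w\<close> is written as a combination of products, except for its (irrelevant)
  values when one of the points is a pole of one of the forms used.\<close>

definition has_component :: "nat \<Rightarrow> W \<Rightarrow> ((nat \<Rightarrow> pline) \<Rightarrow> complex) \<Rightarrow> bool" where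
  "has_component m w \<Phi> \<longleftrightarrow> (\<exists>ts :: (complex \<times> form2 list) list.
     w = (\<Sum>(c, L)\<leftarrow>ts. cst c * prod_list (map iota L)) \<and>
     (\<forall>p. \<Phi> p = (\<Sum>(c, L)\<leftarrow>filter (\<lambda>(c, L). length L = m) ts. c * sym_polydiff L p)))"

inductive polyfun :: "nat \<Rightarrow> ((nat \<Rightarrow> complex) \<Rightarrow> complex) \<Rightarrow> bool" for n :: nat where
  const: "polyfun n (\<lambda>x. c)"
| var: "i < n \<Longrightarrow> polyfun n (\<lambda>x. x i)"
| add: "polyfun n f \<Longrightarrow> polyfun n g \<Longrightarrow> polyfun n (\<lambda>x. f x + g x)"
| mult: "polyfun n f \<Longrightarrow> polyfun n g \<Longrightarrow> polyfun n (\<lambda>x. f x * g x)"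

text \<open>The degree \<open>m\<close> component of \<open>w\<close> is \<open>P/Q\<close> times the product of the differentials of \<open>u\<close> at
  the \<open>m\<close> points, where \<open>P\<close> and \<open>Q\<close> are evaluated at the \<open>u\<close>-values of the points.\<close>

definition component_is ::
  "(pline \<Rightarrow> complex) \<Rightarrow> nat \<Rightarrow> W \<Rightarrow> ((nat \<Rightarrow> complex) \<Rightarrow> complex) \<Rightarrow> ((nat \<Rightarrow> complex) \<Rightarrow> complex) \<Rightarrow> bool"
where
  "component_is u m w P Q \<longleftrightarrow> (\<exists>\<Phi>. has_component m w \<Phi> \<and>
     (\<forall>p. (\<forall>i<m. \<not> pole_at u (p i)) \<longrightarrow> Q (\<lambda>i. u (p i)) \<noteq> 0 \<longrightarrow>
        \<Phi> p = P (\<lambda>i. u (p i)) / Q (\<lambda>i. u (p i)) * (\<Prod>i<m. du u (p i))))"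

text \<open>\<open>F z2\<close>, for \<open>z2\<close> in a punctured Zariski neighbourhood of \<open>z1\<close>, tends to \<open>G\<close>. The variable
  \<open>x m\<close> of \<open>P\<close> and \<open>Q\<close> stands for \<open>u z2\<close>. Since \<open>Q\<close> is not identically zero at \<open>z2 = z1\<close>, the
  quotient \<open>P/Q\<close> has no pole along \<open>z2 = z1\<close>.\<close>

definition W_tendsto :: "(pline \<Rightarrow> complex) \<Rightarrow> pline \<Rightarrow> (pline \<Rightarrow> W) \<Rightarrow> W \<Rightarrow> bool" where
  "W_tendsto u z1 F G \<longleftrightarrow> (\<forall>m. \<exists>P Q. polyfun (Suc m) P \<and> polyfun (Suc m) Q \<and>
     (\<exists>x. Q (x(m := u z1)) \<noteq> 0) \<and>
     (\<exists>Z. finite Z \<and> (\<forall>z2. z2 \<notin> Z \<longrightarrow>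
        component_is u m (F z2) (\<lambda>x. P (x(m := u z2))) (\<lambda>x. Q (x(m := u z2))))) \<and>
     component_is u m G (\<lambda>x. P (x(m := u z1))) (\<lambda>x. Q (x(m := u z1))))"

end

theory Submission
  imports Defs
begin

text \<open>On a vector regular at both points, the commutator of \<open>i(z\<^sub>2)\<close> with multiplication by
  \<open>e\<close> at \<open>z\<^sub>1\<close> is the scalar \<open>\<omega>(z\<^sub>2, z\<^sub>1)\<close>. Bringing \<open>2 b(z\<^sub>2) T(z\<^sub>1)\<close> into normal order therefore
  produces exactly the subtracted term \<open>2 \<omega>(z\<^sub>2, z\<^sub>1) b(z\<^sub>1)\<close>, and what remains is a normally ordered
  expression that makes sense for \<open>z\<^sub>2 = z\<^sub>1\<close>, where it is \<open>S(z\<^sub>1)\<close>. Its components are rational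
  without pole along \<open>z\<^sub>2 = z\<^sub>1\<close> because meromorphic forms on the sphere are rational, coordinates
  are the Moebius functions, and \<open>e\<close> has the kernel \<open>- 1 / (u(x) - u(z\<^sub>2))\<^sup>2\<close>.\<close>

subsection \<open>Rational functions on the sphere\<close>

text \<open>\<open>W_tendsto\<close> asks for one pair \<open>P\<close>, \<open>Q\<close> that
  computes a component at almost all \<open>z2\<close> and also at \<open>z1\<close>. The left side
  itself has no meaning at \<open>z2 = z1\<close>, where \<open>e_form z1\<close> has its pole. It
  is therefore replaced, off finitely many points, by a family that is defined at \<open>z1\<close>
  too, and the limit is the value of this family. For that, families are presented as sums of
  products of a shape independent of the point, with coefficients and forms depending rationally on
  it; sums and products preserve this, so only constants and the factors coming from
  \<open>e\<close> and \<open>i\<close> need inspection. A second obstacle is the domain of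
  \<open>i_field z\<close>, which varies with \<open>z\<close> and has a default value outside. The
  computation uses a derivation of all of \<open>W\<close> instead. It exists on the quotient only
  if its values on generators respect every linear relation, also those between forms with poles at
  \<open>z\<close>.\<close>

definition rat_fun :: "(complex \<Rightarrow> complex) \<Rightarrow> bool" where
  "rat_fun g \<longleftrightarrow> (\<exists>p q Z. q \<noteq> 0 \<and> finite Z \<and> (\<forall>y. y \<notin> Z \<longrightarrow> g y = poly p y / poly q y))"

lemma rat_funI:
  assumes "q \<noteq> 0" "finite Z" "\<And>y. y \<notin> Z \<Longrightarrow> g y = poly p y / poly q y"
  shows "rat_fun g"
  using assms unfolding rat_fun_def by blast

lemma rat_fun_poly: "rat_fun (poly p)"
  by (rule rat_funI[of 1 "{}" _ p]) auto

lemma rat_fun_const: "rat_fun (\<lambda>_. c)"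
  by (rule rat_funI[of 1 "{}" _ "[:c:]"]) auto

lemma rat_fun_cong_finite:
  assumes "rat_fun f" "finite Z" "\<And>y. y \<notin> Z \<Longrightarrow> g y = f y"
  shows "rat_fun g"
proof -
  obtain p q Z' where "q \<noteq> 0" "finite Z'" "\<And>y. y \<notin> Z' \<Longrightarrow> f y = poly p y / poly q y"
    using assms(1) unfolding rat_fun_def by blast
  then show ?thesis
    by (intro rat_funI[of q "Z \<union> Z'" g p]) (use assms in auto)
qed

lemma rat_fun_add:
  assumes "rat_fun f" "rat_fun g"
  shows "rat_fun (\<lambda>y. f y + g y)"
proof -
  obtain p q Z where 1: "q \<noteq> 0" "finite Z" "\<And>y. y \<notin> Z \<Longrightarrow> f y = poly p y / poly q y"
    using assms(1) unfolding rat_fun_def by blast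
  obtain p' q' Z' where 2: "q' \<noteq> 0" "finite Z'" "\<And>y. y \<notin> Z' \<Longrightarrow> g y = poly p' y / poly q' y"
    using assms(2) unfolding rat_fun_def by blast
  show ?thesis
  proof (rule rat_funI[of "q * q'" "Z \<union> Z' \<union> {y. poly q y = 0} \<union> {y. poly q' y = 0}" _ "p * q' + p' * q"])
    show "finite (Z \<union> Z' \<union> {y. poly q y = 0} \<union> {y. poly q' y = 0})"
      using 1 2 by (auto intro: poly_roots_finite)
  qed (use 1 2 in \<open>simp_all add: add_frac_eq\<close>)
qed

lemma rat_fun_mult:
  assumes "rat_fun f" "rat_fun g"
  shows "rat_fun (\<lambda>y. f y * g y)"
proof -
  obtain p q Z where 1: "q \<noteq> 0" "finite Z" "\<And>y. y \<notin> Z \<Longrightarrow> f y = poly p y / poly q y"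
    using assms(1) unfolding rat_fun_def by blast
  obtain p' q' Z' where 2: "q' \<noteq> 0" "finite Z'" "\<And>y. y \<notin> Z' \<Longrightarrow> g y = poly p' y / poly q' y"
    using assms(2) unfolding rat_fun_def by blast
  show ?thesis
    by (rule rat_funI[of "q * q'" "Z \<union> Z'" _ "p * p'"]) (use 1 2 in auto)
qed

lemma rat_fun_inverse:
  assumes "rat_fun f"
  shows "rat_fun (\<lambda>y. inverse (f y))"
proof -
  obtain p q Z where 1: "q \<noteq> 0" "finite Z" "\<And>y. y \<notin> Z \<Longrightarrow> f y = poly p y / poly q y"
    using assms unfolding rat_fun_def by blast
  show ?thesis
  proof (cases "p = 0")
    \<comment> \<open>Division by zero makes the inverse of the zero function zero, so the fraction
      is \<open>0 / 1\<close>; otherwise \<open>p\<close> can serve as denominator.\<close>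
    case True
    then show ?thesis by (intro rat_funI[of 1 Z _ 0]) (use 1 in auto)
  next
    case False
    then show ?thesis by (intro rat_funI[of p Z _ q]) (use 1 in auto)
  qed
qed

lemma rat_fun_divide: "rat_fun f \<Longrightarrow> rat_fun g \<Longrightarrow> rat_fun (\<lambda>y. f y / g y)"
  unfolding divide_inverse by (intro rat_fun_mult rat_fun_inverse)

lemma rat_fun_poly_comp:
  assumes "rat_fun f"
  shows "rat_fun (\<lambda>y. poly p (f y))"
proof (induction p)
  case 0
  then show ?case using rat_fun_const[of 0] by simp
next
  case (pCons a p)
  then show ?case by (simp add: rat_fun_add rat_fun_const rat_fun_mult assms)
qed

text \<open>The exponent is the order of the pole and \<open>c\<close> the leading Laurent
  coefficient. Without a pole \<open>n = 0\<close> works, because a meromorphic function then has a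
  finite limit.\<close>

lemma meromorphic_times_power_limit:
  assumes "h meromorphic_on {s}"
  obtains n c where "(\<lambda>z. h z * (z - s) ^ n) \<midarrow>s\<rightarrow> c"
proof (cases "is_pole h s")
  case True
  from assms have "isolated_singularity_at h s" by (simp add: meromorphic_at_iff)
  then obtain r where r: "r > 0" "h analytic_on ball s r - {s}"
    by (auto simp: isolated_singularity_at_def)
  have "s \<in> ball s r" using r(1) by simp
  note * = zorder_exist_pole[OF analytic_imp_holomorphic[OF r(2)] open_ball this True]
  define P where "P = zor_poly h s"
  from * obtain d where P: "d > 0" "P holomorphic_on cball s d"
      "\<And>w. w \<in> cball s d - {s} \<Longrightarrow> h w = P w / (w - s) ^ nat (- zorder h s)"
    unfolding P_def by (elim conjE exE) blast
  have "P analytic_on {s}"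
    using P(1) holomorphic_on_subset[OF P(2) ball_subset_cball]
    by (auto simp: analytic_at intro!: exI[of _ "ball s d"])
  then have "P \<midarrow>s\<rightarrow> P s"
    using analytic_at_imp_isCont isContD by blast
  moreover have "\<forall>\<^sub>F w in at s. P w = h w * (w - s) ^ nat (- zorder h s)"
    using eventually_at_in_open[OF open_ball, of s s d] P(1)
    by (auto elim!: eventually_mono simp: P(3))
  ultimately have "(\<lambda>w. h w * (w - s) ^ nat (- zorder h s)) \<midarrow>s\<rightarrow> P s"
    by (rule Lim_transform_eventually)
  then show thesis by (rule that)
next
  case False
  with assms obtain c where "h \<midarrow>s\<rightarrow> c"
    unfolding meromorphic_at_iff not_essential_def by blast
  then show thesis using that[of 0 c] by simp
qed

lemma rat_fun_of_meromorphic_aux: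
  assumes "finite S"
  shows "h meromorphic_on UNIV \<Longrightarrow> (\<lambda>w. h (1 / w)) meromorphic_on {0} \<Longrightarrow>
    (\<And>z. z \<notin> S \<Longrightarrow> h analytic_on {z}) \<Longrightarrow> rat_fun h"
  using assms
proof (induction S arbitrary: h rule: finite_induct)
  case empty
  then have hol: "h holomorphic_on UNIV"
    by (meson analytic_imp_holomorphic analytic_on_analytic_at empty_iff)
  have "not_essential (\<lambda>w. h (1 / w)) 0"
    using empty by (simp add: meromorphic_at_iff)
  \<comment> \<open>\<open>pole_at_infinity\<close> recognises polynomials by a finite limit of
    \<open>inverse \<circ> h\<close>. This covers a nonzero limit of \<open>h\<close> and a pole;
    the limit \<open>0\<close> forces \<open>h = 0\<close> by Liouville's theorem.\<close>
  then consider c where "(\<lambda>w. h (1 / w)) \<midarrow>0\<rightarrow> c" "c \<noteq> 0" | "(\<lambda>w. h (1 / w)) \<midarrow>0\<rightarrow> 0"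
    | "is_pole (\<lambda>w. h (1 / w)) 0"
    unfolding not_essential_def by blast
  then show ?case
  proof cases
    case 1
    then have "((\<lambda>w. (inverse \<circ> h) (inverse w)) \<longlongrightarrow> inverse c) (at 0)"
      by (auto simp: o_def divide_inverse intro!: tendsto_inverse)
    then have "((inverse \<circ> h) \<longlongrightarrow> inverse c) at_infinity"
      using lim_at_infinity_0 by (auto simp: o_def)
    then obtain a n where "\<And>z. h z = (\<Sum>i\<le>n. a i * z ^ i)"
      using pole_at_infinity[OF hol] by metis
    then have "h = poly (\<Sum>i\<le>n. monom (a i) i)"
      by (auto simp: poly_sum poly_monom)
    then show ?thesis by (simp add: rat_fun_poly)
  next
    case 2
    then have "(h \<longlongrightarrow> 0) at_infinity"
      using lim_at_infinity_0[of h 0] by (simp add: divide_inverse o_def)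
    then have "h = (\<lambda>_. 0)" using Liouville_weak[OF hol] by blast
    then show ?thesis by (simp add: rat_fun_const)
  next
    case 3
    then have "((\<lambda>w. (inverse \<circ> h) (inverse w)) \<longlongrightarrow> 0) (at 0)"
      unfolding is_pole_def o_def divide_inverse mult_1
      using filterlim_compose[OF tendsto_inverse_0] by blast
    then have "((inverse \<circ> h) \<longlongrightarrow> 0) at_infinity"
      using lim_at_infinity_0 by (auto simp: o_def)
    then obtain a n where "\<And>z. h z = (\<Sum>i\<le>n. a i * z ^ i)"
      using pole_at_infinity[OF hol] by metis
    then have "h = poly (\<Sum>i\<le>n. monom (a i) i)"
      by (auto simp: poly_sum poly_monom)
    then show ?thesis by (simp add: rat_fun_poly)
  qed
next
  case (insert s S)
  have "h meromorphic_on {s}"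
    using insert.prems(1) meromorphic_on_subset by blast
  then obtain n c where c: "(\<lambda>z. h z * (z - s) ^ n) \<midarrow>s\<rightarrow> c"
    by (rule meromorphic_times_power_limit)
  \<comment> \<open>The value \<open>c\<close> makes \<open>h'\<close> continuous at
    \<open>s\<close>. A continuous meromorphic function is analytic, so \<open>s\<close> leaves the
    exceptional set.\<close>
  define h' where "h' = (\<lambda>z. if z = s then c else h z * (z - s) ^ n)"
  have ev: "\<forall>\<^sub>F z in nhds w. h' z = h z * (z - s) ^ n" if "w \<noteq> s" for w
    using t1_space_nhds[OF that] by eventually_elim (auto simp: h'_def)
  have evs: "\<forall>\<^sub>F z in at w. h' z = h z * (z - s) ^ n" for w
  proof (cases "w = s")
    case True
    then show ?thesis by (auto simp: h'_def eventually_at_filter)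
  next
    case False
    then show ?thesis using ev eventually_nhds_conv_at by blast
  qed
  have mer: "h' meromorphic_on UNIV"
  proof -
    have "(\<lambda>z. h z * (z - s) ^ n) meromorphic_on UNIV"
      by (intro meromorphic_intros insert.prems)
    then show ?thesis using meromorphic_on_cong[of UNIV h' _ UNIV, OF evs refl] by blast
  qed
  have "rat_fun h'"
  proof (rule insert.IH[OF mer])
    have 1: "(\<lambda>w. h (1 / w) * (1 / w - s) ^ n) meromorphic_on {0}"
      by (intro meromorphic_intros insert.prems)
    have "\<forall>\<^sub>F w in at 0. h' (1 / w) = h (1 / w) * (1 / w - s) ^ n"
    proof (cases "s = 0")
      case True
      then show ?thesis by (auto simp: eventually_at_filter h'_def)
    next
      case False
      then have "\<forall>\<^sub>F w in at 0. w \<noteq> 1 / s"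
        by (simp add: eventually_neq_at_within)
      then show ?thesis
        by (rule eventually_mono) (use False in \<open>auto simp: h'_def field_simps\<close>)
    qed
    with 1 show "(\<lambda>w. h' (1 / w)) meromorphic_on {0}"
      using meromorphic_on_cong[of "{0}" "\<lambda>w. h' (1 / w)" "\<lambda>w. h (1 / w) * (1 / w - s) ^ n" "{0}"]
      by auto
  next
    fix z assume z: "z \<notin> S"
    show "h' analytic_on {z}"
    proof (cases "z = s")
      case True
      have "isCont h' s"
        unfolding isCont_def using c tendsto_cong[OF evs[of s]] by (simp add: h'_def)
      then show ?thesis
        using True mer by (intro meromorphic_at_isCont_imp_analytic) (auto intro: meromorphic_on_subset)
    next
      case False
      have "(\<lambda>z. h z * (z - s) ^ n) analytic_on {z}"
        using False z insert.prems by (intro analytic_intros) auto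
      then show ?thesis using analytic_at_cong[OF ev[OF False]] by blast
    qed
  qed
  then have "rat_fun (\<lambda>z. h' z / poly ([:-s, 1:] ^ n) z)"
    by (intro rat_fun_divide rat_fun_poly)
  then show ?case
    by (rule rat_fun_cong_finite[of _ "{s}"]) (auto simp: h'_def)
qed

text \<open>This rests on the compactness of the sphere: the poles are finite in number, and
  multiplying them away leaves an entire function without essential singularity at infinity.\<close>

lemma rat_fun_of_meromorphic:
  assumes "h meromorphic_on UNIV" "(\<lambda>w. h (1 / w)) meromorphic_on {0}"
  shows "rat_fun h"
proof -
  from assms(2) have "isolated_singularity_at (\<lambda>w. h (1 / w)) 0" by (simp add: meromorphic_at_iff)
  then obtain r where r: "r > 0" "(\<lambda>w. h (1 / w)) analytic_on ball 0 r - {0}"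
    by (auto simp: isolated_singularity_at_def)
  define S where "S = cball 0 (1 / r) \<inter> {w. \<not> h analytic_on {w}}"
  have "{w. \<not> h analytic_on {w}} sparse_in cball 0 (1 / r)"
    using assms(1) meromorphic_on_imp_sparse_singularities meromorphic_on_subset by blast
  then have "finite S"
    unfolding S_def by (intro sparse_in_compact_finite) auto
  moreover have "h analytic_on {z}" if "z \<notin> S" for z
  proof (cases "z \<in> cball 0 (1 / r)")
    case True
    then show ?thesis using that by (simp add: S_def)
  next
    case False
    then have z: "norm z > 1 / r" by (simp add: dist_norm)
    then have "z \<noteq> 0" using r(1) by (auto simp: not_less)
    then have "1 / z \<in> ball 0 r - {0}"
      using z r(1) by (auto simp: dist_norm norm_divide field_simps)
    then have "(\<lambda>w. h (1 / w)) analytic_on {1 / z}"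
      using analytic_on_subset[OF r(2), of "{1 / z}"] by (simp del: one_divide_eq_0_iff)
    moreover have "(\<lambda>w. 1 / w) analytic_on {z}"
      using \<open>z \<noteq> 0\<close> by (intro analytic_on_divide analytic_on_const analytic_on_id) auto
    ultimately have "((\<lambda>w. h (1 / w)) \<circ> (\<lambda>w. 1 / w)) analytic_on {z}"
      using analytic_on_compose_gen[of "\<lambda>w. 1 / w" "{z}" _ "{1 / z}"] by blast
    then show ?thesis by (simp add: o_def)
  qed
  ultimately show ?thesis
    using rat_fun_of_meromorphic_aux assms by blast
qed

subsection \<open>Coordinates\<close>

text \<open>Division by zero gives \<open>mob\<close> the value \<open>0\<close> at its pole, as \<open>nicely_meromorphic_on\<close> demands.\<close>

fun mob :: "complex \<Rightarrow> complex \<Rightarrow> complex \<Rightarrow> complex \<Rightarrow> pline \<Rightarrow> complex" where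
  "mob a b c d (Aff t) = (a * t + b) / (c * t + d)"
| "mob a b c d Infty = a / c"

text \<open>The denominator in homogeneous coordinates \<open>(t : 1)\<close> and
  \<open>(1 : 0)\<close>, so that its zero is the pole also at infinity.\<close>

fun mob_den :: "complex \<Rightarrow> complex \<Rightarrow> pline \<Rightarrow> complex" where
  "mob_den c d (Aff t) = c * t + d"
| "mob_den c d Infty = c"

text \<open>In the chart at infinity the function has the same shape with \<open>a\<close>,
  \<open>b\<close> and \<open>c\<close>, \<open>d\<close> interchanged, and the determinant changes
  sign. Each analytic fact is therefore proved once for fractional linear functions and serves both
  charts.\<close>

lemma mob_chart:
  "mob a b c d \<circ> chart (Aff s) = (\<lambda>w. (a * w + b) / (c * w + d))"
  "mob a b c d \<circ> chart Infty = (\<lambda>w. (b * w + a) / (d * w + c))"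
proof -
  show "mob a b c d \<circ> chart Infty = (\<lambda>w. (b * w + a) / (d * w + c))"
  proof
    fix w :: complex
    show "(mob a b c d \<circ> chart Infty) w = (b * w + a) / (d * w + c)"
    proof (cases "w = 0")
      case False
      then have "a / w + b = (b * w + a) / w" "c / w + d = (d * w + c) / w"
        by (simp_all add: field_simps)
      with False show ?thesis by simp
    qed simp
  qed
qed auto

context
  fixes a b c d :: complex
  assumes det: "a * d - b * c \<noteq> 0"
begin

lemma frac_linear_analytic:
  assumes "c * w + d \<noteq> 0"
  shows "(\<lambda>w. (a * w + b) / (c * w + d)) analytic_on {w}"
  using assms by (intro analytic_intros) auto

lemma frac_linear_pole_form:
  assumes "c * w0 + d = 0"
  shows "c \<noteq> 0" "a * w0 + b \<noteq> 0"
    "(a * w + b) / (c * w + d) = ((a * w + b) / c) / (w - w0) ^ 1"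
proof -
  show c: "c \<noteq> 0" using assms det by auto
  have d: "d = - c * w0" using assms by (simp add: eq_neg_iff_add_eq_0 add.commute)
  show "a * w0 + b \<noteq> 0"
  proof
    assume "a * w0 + b = 0"
    then have "b = - a * w0" by (simp add: eq_neg_iff_add_eq_0 add.commute)
    with d det show False by simp
  qed
  show "(a * w + b) / (c * w + d) = ((a * w + b) / c) / (w - w0) ^ 1"
    using c d by (simp add: right_diff_distrib)
qed

lemma frac_linear_is_pole_iff:
  "is_pole (\<lambda>w. (a * w + b) / (c * w + d)) w0 \<longleftrightarrow> c * w0 + d = 0"
proof
  assume "is_pole (\<lambda>w. (a * w + b) / (c * w + d)) w0"
  then show "c * w0 + d = 0"
    using frac_linear_analytic analytic_at_imp_no_pole by blast
next
  assume *: "c * w0 + d = 0"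
  show "is_pole (\<lambda>w. (a * w + b) / (c * w + d)) w0"
    unfolding frac_linear_pole_form(3)[OF *]
    by (rule is_pole_basic[of _ UNIV])
      (use frac_linear_pole_form(1,2)[OF *] in \<open>auto intro!: holomorphic_intros\<close>)
qed

lemma frac_linear_zorder:
  assumes "c * w0 + d = 0"
  shows "zorder (\<lambda>w. (a * w + b) / (c * w + d)) w0 = -1"
proof (rule zorder_eqI[of UNIV])
  show "(\<lambda>w. (a * w + b) / c) holomorphic_on UNIV"
    using frac_linear_pole_form(1)[OF assms] by (intro holomorphic_intros) auto
  show "(a * w0 + b) / c \<noteq> 0"
    using frac_linear_pole_form(1,2)[OF assms] by simp
  show "(a * w + b) / (c * w + d) = (a * w + b) / c * (w - w0) powi - 1" for w
    unfolding frac_linear_pole_form(3)[OF assms, of w] by (simp add: divide_inverse power_int_minus)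
qed auto

lemma frac_linear_nicely_meromorphic:
  "(\<lambda>w. (a * w + b) / (c * w + d)) nicely_meromorphic_on {w0}"
proof (cases "c * w0 + d = 0")
  case True
  have "(\<lambda>w. (a * w + b) / (c * w + d)) meromorphic_on {w0}"
    by (intro meromorphic_intros)
  then show ?thesis
    using True frac_linear_is_pole_iff by (simp add: nicely_meromorphic_on_def)
next
  case False
  then show ?thesis
    by (intro analytic_on_imp_nicely_meromorphic_on frac_linear_analytic)
qed

lemma frac_linear_deriv:
  assumes "c * w + d \<noteq> 0"
  shows "deriv (\<lambda>w. (a * w + b) / (c * w + d)) w = (a * d - b * c) / (c * w + d)\<^sup>2"
proof (rule DERIV_imp_deriv)
  show "((\<lambda>w. (a * w + b) / (c * w + d)) has_field_derivative (a * d - b * c) / (c * w + d)\<^sup>2) (at w)"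
    using assms
    by (auto intro!: derivative_eq_intros simp: power2_eq_square algebra_simps)
qed

end

lemma pole_at_mob:
  assumes "a * d - b * c \<noteq> 0"
  shows "pole_at (mob a b c d) z \<longleftrightarrow> mob_den c d z = 0"
proof (cases z)
  case (Aff t)
  then show ?thesis
    unfolding pole_at_def mob_chart Aff using frac_linear_is_pole_iff[OF assms] by simp
next
  case Infty
  have "b * c - a * d \<noteq> 0" using assms by auto
  then show ?thesis
    unfolding pole_at_def mob_chart Infty using frac_linear_is_pole_iff[of b c a d 0] by simp
qed

lemma du_mob:
  assumes "a * d - b * c \<noteq> 0"
  shows "c * t + d \<noteq> 0 \<Longrightarrow> du (mob a b c d) (Aff t) = (a * d - b * c) / (c * t + d)\<^sup>2"
    and "c \<noteq> 0 \<Longrightarrow> du (mob a b c d) Infty = - (a * d - b * c) / c\<^sup>2"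
proof -
  assume "c * t + d \<noteq> 0"
  then show "du (mob a b c d) (Aff t) = (a * d - b * c) / (c * t + d)\<^sup>2"
    unfolding du_def mob_chart using frac_linear_deriv[OF assms, of t] by simp
next
  assume "c \<noteq> 0"
  moreover have "b * c - a * d \<noteq> 0" using assms by auto
  ultimately show "du (mob a b c d) Infty = - (a * d - b * c) / c\<^sup>2"
    unfolding du_def mob_chart using frac_linear_deriv[of b c a d 0] by simp
qed

lemma coordinate_mob:
  assumes det: "a * d - b * c \<noteq> 0"
  shows "coordinate (mob a b c d)"
proof -
  have det': "b * c - a * d \<noteq> 0" using det by auto
  have "mero_fun (mob a b c d)"
    unfolding mero_fun_def
  proof
    fix z show "mob a b c d \<circ> chart z nicely_meromorphic_on {chart_pt z}"
      using frac_linear_nicely_meromorphic[OF det] frac_linear_nicely_meromorphic[OF det']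
      by (cases z) (simp_all only: mob_chart)
  qed
  moreover have "\<exists>!p. mob_den c d p = 0"
  proof (cases "c = 0")
    case True
    with det have "mob_den c d p = 0 \<longleftrightarrow> p = Infty" for p by (cases p) auto
    then show ?thesis by simp
  next
    case False
    then have "mob_den c d p = 0 \<longleftrightarrow> p = Aff (- d / c)" for p
      by (cases p) (auto simp: field_simps eq_neg_iff_add_eq_0)
    then show ?thesis by simp
  qed
  moreover have "zorder (mob a b c d \<circ> chart p) (chart_pt p) = -1" if "mob_den c d p = 0" for p
  proof (cases p)
    case (Aff t)
    then show ?thesis
      using frac_linear_zorder[OF det, of t] that by (simp only: mob_chart chart_pt.simps mob_den.simps)
  next
    case Infty
    then show ?thesis
      using frac_linear_zorder[OF det', of 0] that
      by (simp only: mob_chart chart_pt.simps mob_den.simps mult_zero_right add_0)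
  qed
  ultimately show ?thesis
    unfolding coordinate_def pole_at_mob[OF det] by blast
qed

section \<open>Coordinates are Moebius functions\<close>

lemma linear_of_linear_growth:
  fixes f :: "complex \<Rightarrow> complex"
  assumes "f holomorphic_on UNIV" "\<And>t. A \<le> norm t \<Longrightarrow> norm (f t) \<le> B * norm t"
  obtains k0 k1 where "\<And>t. f t = k1 * t + k0"
proof (rule that)
  fix t
  show "f t = deriv f 0 * t + f 0"
    using Liouville_polynomial[OF assms(1), of A B 1 t] assms(2) by (simp add: algebra_simps)
qed

lemma continuous_bounded_nhd:
  fixes f :: "complex \<Rightarrow> complex"
  assumes "isCont f 0"
  obtains r where "r > 0" "\<And>w. norm w < r \<Longrightarrow> norm (f w) \<le> norm (f 0) + 1"
proof -
  obtain r where "r > 0" "\<And>w. norm w < r \<Longrightarrow> norm (f w - f 0) < 1"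
    using assms unfolding continuous_at_eps_delta dist_norm by (metis diff_zero zero_less_one)
  then show thesis
    using that norm_triangle_sub[of "f _" "f 0"] by (smt (verit))
qed

text \<open>Liouville's theorem for linear growth. If the pole is at infinity, \<open>h\<close> is
  entire and equals \<open>P (1 / t) * t\<close> for large \<open>t\<close>, with \<open>P\<close>
  bounded near \<open>0\<close>. If it is at \<open>s\<close>, then \<open>h t * (t - s)\<close>
  extends to an entire function, of linear growth because \<open>u\<close> is bounded near
  infinity.\<close>

lemma coordinate_imp_mob:
  assumes "coordinate u"
  obtains a b c d where "a * d - b * c \<noteq> 0" "u = mob a b c d"
proof -
  obtain p where p: "pole_at u p" and uniq: "\<And>z. pole_at u z \<Longrightarrow> z = p"
    and zo: "zorder (u \<circ> chart p) (chart_pt p) = -1"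
    using assms unfolding coordinate_def by metis
  have nice: "u \<circ> chart z nicely_meromorphic_on {chart_pt z}" for z
    using assms unfolding coordinate_def mero_fun_def by blast
  have ana: "u \<circ> chart z analytic_on {chart_pt z}" if "z \<noteq> p" for z
    using nicely_meromorphic_on_imp_analytic_at[OF nice[of z]] that uniq[of z]
    by (auto simp: pole_at_def)
  \<comment> \<open>There is no finite limit at a pole, so \<open>nicely_meromorphic_on\<close>
    fixes the value. It matters because \<open>u\<close> and \<open>mob\<close> have to agree as
    functions, also at \<open>p\<close>.\<close>
  have zero: "u p = 0"
  proof -
    have pole: "is_pole (u \<circ> chart p) (chart_pt p)" using p by (simp add: pole_at_def)
    moreover have "\<not> (u \<circ> chart p) \<midarrow>chart_pt p\<rightarrow> (u \<circ> chart p) (chart_pt p)"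
      using pole unfolding is_pole_def
      using not_tendsto_and_filterlim_at_infinity trivial_limit_at by blast
    ultimately have "(u \<circ> chart p) (chart_pt p) = 0"
      using nice[of p] unfolding nicely_meromorphic_on_def by blast
    then show ?thesis by (cases p) auto
  qed
  define h where "h = (\<lambda>t. u (Aff t))"
  have chA: "u \<circ> chart (Aff s) = h" for s by (auto simp: h_def)
  obtain r P where r: "r > 0" and P: "P (chart_pt p) \<noteq> 0" "P holomorphic_on cball (chart_pt p) r"
    and Peq: "\<And>w. w \<in> cball (chart_pt p) r - {chart_pt p} \<Longrightarrow>
      (u \<circ> chart p) w = P w / (w - chart_pt p)"
  proof -
    have "isolated_singularity_at (u \<circ> chart p) (chart_pt p)"
      using nice[of p] unfolding nicely_meromorphic_on_def meromorphic_at_iff by blast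
    then obtain r where r: "r > 0" "u \<circ> chart p analytic_on ball (chart_pt p) r - {chart_pt p}"
      by (auto simp: isolated_singularity_at_def)
    have "chart_pt p \<in> ball (chart_pt p) r" using r(1) by simp
    from zorder_exist_pole[OF analytic_imp_holomorphic[OF r(2)] open_ball this p[unfolded pole_at_def]]
    show thesis
      unfolding zo
      by (elim conjE exE, intro that[of _ "zor_poly (u \<circ> chart p) (chart_pt p)"]) auto
  qed
  have Pana: "P analytic_on {chart_pt p}"
    using r holomorphic_on_subset[OF P(2) ball_subset_cball]
    by (auto simp: analytic_at intro!: exI[of _ "ball (chart_pt p) r"])
  show thesis
  proof (cases p)
    case Infty
    have hol: "h holomorphic_on UNIV"
      using ana[of "Aff _"] Infty chA
      by (metis analytic_imp_holomorphic analytic_on_analytic_at chart_pt.simps(1) pline.distinct(1))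
    have "isCont P 0" using Pana analytic_at_imp_isCont Infty by simp
    then obtain r' where r': "r' > 0" "\<And>w. norm w < r' \<Longrightarrow> norm (P w) \<le> norm (P 0) + 1"
      by (rule continuous_bounded_nhd) blast
    have hP: "h t = P (1 / t) * t" if "norm t > 1 / r" "t \<noteq> 0" for t
    proof -
      have "1 / t \<in> cball 0 r - {0}" using that r by (simp add: norm_divide field_simps)
      then show ?thesis using Peq[of "1 / t"] that Infty by (simp add: h_def)
    qed
    have "norm (h t) \<le> (norm (P 0) + 1) * norm t" if "1 / r + 1 / r' + 1 \<le> norm t" for t
    proof -
      have "1 / r > 0" "1 / r' > 0" using r r' by auto
      then have t: "norm t > 1 / r" "norm t > 1 / r'" "t \<noteq> 0"
        using that by (auto simp del: zero_less_divide_1_iff)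
      then have "norm (1 / t) < r'" using r' by (simp add: norm_divide field_simps)
      then show ?thesis
        unfolding hP[OF t(1,3)] norm_mult by (intro mult_right_mono r') auto
    qed
    then obtain k0 k1 where k: "\<And>t. h t = k1 * t + k0"
      using linear_of_linear_growth[OF hol] by metis
    have "u z = mob k1 k0 0 1 z" for z
      using zero k Infty by (cases z) (auto simp: h_def)
    then have u: "u = mob k1 k0 0 1" by blast
    \<comment> \<open>For \<open>k1 = 0\<close> the function would be constant near infinity and
      have no pole there.\<close>
    have "k1 \<noteq> 0"
    proof
      assume "k1 = 0"
      then have "\<forall>\<^sub>F w in at 0. (u \<circ> chart Infty) w = k0"
        using k by (auto simp: eventually_at_filter h_def)
      then have "(u \<circ> chart Infty) \<midarrow>0\<rightarrow> k0" by (rule tendsto_eventually)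
      then show False
        using p not_tendsto_and_filterlim_at_infinity[OF trivial_limit_at]
        unfolding Infty pole_at_def is_pole_def chart_pt.simps by blast
    qed
    with u show thesis using that[of k1 1 k0 0] by simp
  next
    case (Aff s)
    have hana: "h analytic_on {t}" if "t \<noteq> s" for t
      using ana[of "Aff t"] that unfolding chA by (simp add: Aff)
    define k where "k = (\<lambda>t. if t = s then P s else h t * (t - s))"
    have kana: "k analytic_on {t}" for t
    proof (cases "t = s")
      case True
      have "\<forall>\<^sub>F t in nhds s. t \<in> ball s r" by (rule eventually_nhds_in_open) (use r in auto)
      then have "\<forall>\<^sub>F t in nhds s. k t = P t"
        by eventually_elim (use Peq Aff in \<open>auto simp: k_def h_def\<close>)
      then show ?thesis using Pana True Aff analytic_at_cong by auto
    next
      case False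
      have "\<forall>\<^sub>F w in nhds t. k w = h w * (w - s)"
        using t1_space_nhds[OF False] by eventually_elim (auto simp: k_def)
      moreover have "(\<lambda>w. h w * (w - s)) analytic_on {t}"
        by (intro analytic_intros hana False)
      ultimately show ?thesis
        using analytic_at_cong[of k "\<lambda>w. h w * (w - s)" t t] by simp
    qed
    then have hol: "k holomorphic_on UNIV"
      by (metis analytic_imp_holomorphic analytic_on_analytic_at)
    have cont: "isCont (u \<circ> chart Infty) 0"
      using ana[of Infty] Aff analytic_at_imp_isCont by simp
    then obtain r' where r': "r' > 0"
        "\<And>w. norm w < r' \<Longrightarrow> norm ((u \<circ> chart Infty) w) \<le> norm ((u \<circ> chart Infty) 0) + 1"
      by (rule continuous_bounded_nhd) blast
    define M where "M = norm ((u \<circ> chart Infty) 0) + 1"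
    have "norm (k t) \<le> (M * (1 + norm s)) * norm t" if "1 / r' + norm s + 1 \<le> norm t" for t
    proof -
      have "1 / r' > 0" using r' by auto
      then have "norm t > 1 / r'" "norm t \<ge> 1" "norm t > norm s"
        using that norm_ge_zero[of s] by linarith+
      then have t: "norm t > 1 / r'" "norm t \<ge> 1" "t \<noteq> s" "t \<noteq> 0"
        by auto
      then have "norm (1 / t) < r'" using r' by (simp add: norm_divide field_simps)
      then have "norm (h t) \<le> M" using r'(2)[of "1 / t"] t by (simp add: M_def h_def)
      moreover have "norm (t - s) \<le> (1 + norm s) * norm t"
        using norm_triangle_ineq4[of t s] mult_left_mono[OF t(2), of "norm s"]
        by (simp add: algebra_simps)
      ultimately have "norm (h t) * norm (t - s) \<le> M * ((1 + norm s) * norm t)"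
        by (intro mult_mono) (auto simp: M_def)
      then show ?thesis using t(3) by (simp add: k_def norm_mult mult.assoc)
    qed
    then obtain k0 k1 where k: "\<And>t. k t = k1 * t + k0"
      using linear_of_linear_growth[OF hol] by metis
    have heq: "h t = (k1 * t + k0) / (t - s)" for t
      using k[of t] zero Aff by (cases "t = s") (auto simp: k_def h_def field_simps)
    \<comment> \<open>The formula for \<open>h\<close> covers finite points only; the value at
      infinity follows by continuity.\<close>
    have "u Infty = k1"
    proof -
      have lim: "(u \<circ> chart Infty) \<midarrow>0\<rightarrow> u Infty" using cont by (simp add: isCont_def)
      have "(\<lambda>w. (k0 * w + k1) / (- s * w + 1)) \<midarrow>0\<rightarrow> (k0 * 0 + k1) / (- s * 0 + 1)"
        by (intro tendsto_intros) auto
      moreover have "\<forall>\<^sub>F w in at 0. (k0 * w + k1) / (- s * w + 1) = (u \<circ> chart Infty) w"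
      proof (subst eventually_at_filter, rule always_eventually, intro allI impI)
        fix w :: complex assume "w \<noteq> 0"
        then show "(k0 * w + k1) / (- s * w + 1) = (u \<circ> chart Infty) w"
          using heq[of "1 / w"] fun_cong[OF mob_chart(2)[of k1 k0 1 "- s"], of w]
          by (simp add: h_def)
      qed
      ultimately have "(u \<circ> chart Infty) \<midarrow>0\<rightarrow> (k0 * 0 + k1) / (- s * 0 + 1)"
        by (rule Lim_transform_eventually)
      from LIM_unique[OF lim this] show ?thesis by simp
    qed
    then have "u z = mob k1 k0 1 (- s) z" for z
      using heq by (cases z) (auto simp: h_def)
    then have "u = mob k1 k0 1 (- s)" by blast
    \<comment> \<open>The determinant is \<open>- k s\<close>, and \<open>k s = P s\<close> is the
      nonzero residue of the simple pole.\<close>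
    moreover have "k1 * (- s) - k0 * 1 \<noteq> 0"
      using k[of s] P(1) Aff by (auto simp: k_def algebra_simps neg_eq_iff_add_eq_0)
    ultimately show thesis using that by blast
  qed
qed

text \<open>The coefficient of \<open>du du' / (u - u')\<^sup>2\<close> in the charts, where \<open>dt = - ds / s\<^sup>2\<close> at infinity. On the
  diagonal it takes the junk value \<open>0\<close>, which is the value of a form at its pole.\<close>

fun bidiff :: "pline \<Rightarrow> pline \<Rightarrow> complex" where
  "bidiff (Aff s) (Aff t) = 1 / (s - t)\<^sup>2"
| "bidiff Infty (Aff t) = -1"
| "bidiff (Aff t) Infty = -1"
| "bidiff Infty Infty = 0"

lemma mob_diff:
  assumes "c * s + d \<noteq> 0"
  shows "c * t + d \<noteq> 0 \<Longrightarrow>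
      mob a b c d (Aff s) - mob a b c d (Aff t) = (a * d - b * c) * (s - t) / ((c * s + d) * (c * t + d))"
    and "c \<noteq> 0 \<Longrightarrow>
      mob a b c d (Aff s) - mob a b c d Infty = - (a * d - b * c) / ((c * s + d) * c)"
  using assms by (simp_all add: divide_simps) (simp_all add: algebra_simps)

lemma coordinate_inj:
  assumes u: "coordinate u" and "\<not> pole_at u x" "\<not> pole_at u z" "u x = u z"
  shows "x = z"
proof -
  from u obtain a b c d where det: "a * d - b * c \<noteq> 0" and u: "u = mob a b c d"
    by (rule coordinate_imp_mob)
  have AI: "mob a b c d (Aff s) \<noteq> mob a b c d Infty" if "c * s + d \<noteq> 0" "c \<noteq> 0" for s
    using mob_diff(2)[of c s d a b] that det by fastforce
  show ?thesis
  proof (cases x; cases z)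
    fix s t assume *: "x = Aff s" "z = Aff t"
    with assms(2,3) have "c * s + d \<noteq> 0" "c * t + d \<noteq> 0"
      unfolding u pole_at_mob[OF det] by auto
    then show ?thesis
      using mob_diff(1)[of c s d t a b] det assms(4) * unfolding u by (simp del: mob.simps)
  next
    fix s assume *: "x = Aff s" "z = Infty"
    then show ?thesis using AI[of s] assms(2-4) unfolding u pole_at_mob[OF det] by auto
  next
    fix s assume *: "x = Infty" "z = Aff s"
    then show ?thesis using AI[of s] assms(2-4) unfolding u pole_at_mob[OF det] by auto
  qed auto
qed

lemma du_nonzero:
  assumes "coordinate u" "\<not> pole_at u x"
  shows "du u x \<noteq> 0"
proof -
  from assms(1) obtain a b c d where det: "a * d - b * c \<noteq> 0" and u: "u = mob a b c d"
    by (rule coordinate_imp_mob)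
  show ?thesis
    using assms(2) det unfolding u pole_at_mob[OF det]
    by (cases x) (auto simp: du_mob)
qed

text \<open>With \<open>D\<close> the determinant and \<open>X\<close>, \<open>Y\<close> the
  denominators at two finite points, the differentials are \<open>D / X^2\<close> and
  \<open>D / Y^2\<close>, and the values differ by \<open>D * (s - t) / (X * Y)\<close>: everything
  but \<open>s - t\<close> cancels, and similarly at infinity. This invariance makes the
  descriptions \<open>omega\<close> and \<open>e_form\<close> independent of the coordinate.\<close>

lemma coordinate_bidiff:
  assumes u: "coordinate u" and "\<not> pole_at u x" "\<not> pole_at u z" "x \<noteq> z"
  shows "du u x * du u z / (u x - u z)\<^sup>2 = bidiff x z"
proof -
  from u obtain a b c d where det: "a * d - b * c \<noteq> 0" and u: "u = mob a b c d"
    by (rule coordinate_imp_mob)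
  have aux: "D / X\<^sup>2 * (D / Y\<^sup>2) / (D * r / (X * Y))\<^sup>2 = 1 / r\<^sup>2"
     "D / X\<^sup>2 * (- D / Y\<^sup>2) / (- D / (X * Y))\<^sup>2 = - 1"
    if "D \<noteq> 0" "X \<noteq> 0" "Y \<noteq> 0" for D X Y r :: complex
    using that by (auto simp: field_simps power2_eq_square)
  have AA: ?thesis if "x = Aff s" "z = Aff t" for s t
    using assms(2-4) det aux(1)[OF det, of "c * s + d" "c * t + d" "s - t"]
    unfolding u that pole_at_mob[OF det] by (simp add: du_mob mob_diff del: mob.simps)
  have AI: "du u (Aff s) * du u Infty / (u (Aff s) - u Infty)\<^sup>2 = -1"
    if "\<not> pole_at u (Aff s)" "\<not> pole_at u Infty" for s
    using that det aux(2)[OF det, of "c * s + d" c]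
    unfolding u that pole_at_mob[OF det] by (simp add: du_mob mob_diff del: mob.simps)
  show ?thesis
  proof (cases x; cases z)
    fix s t assume "x = Aff s" "z = Aff t"
    then show ?thesis by (rule AA)
  next
    fix s assume "x = Aff s" "z = Infty"
    then show ?thesis using AI[of s] assms by simp
  next
    fix s assume "x = Infty" "z = Aff s"
    then show ?thesis using AI[of s] assms by (simp add: power2_commute mult.commute)
  qed (use assms in auto)
qed

text \<open>The function \<open>1 / (t - s)\<close> for a point \<open>s\<close> avoiding the two
  given ones. Without such a coordinate the conditions in \<open>omega\<close> and
  \<open>e_form\<close> could hold vacuously and would not single out an object.\<close>

lemma ex_coordinate_regular:
  obtains u where "coordinate u" "\<not> pole_at u x" "\<not> pole_at u z"
proof -
  have "infinite (range Aff)"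
    by (simp add: finite_image_iff inj_def infinite_UNIV_char_0)
  then obtain p where p: "p \<in> range Aff" "p \<noteq> x" "p \<noteq> z"
    by (metis finite.emptyI finite_insert finite_subset insertCI subsetI)
  then obtain s where s: "p = Aff s" by blast
  have det: "0 * (- s) - 1 * 1 \<noteq> (0 :: complex)" by simp
  have "mob_den 1 (- s) y \<noteq> 0" if "y \<noteq> p" for y
    using that s by (cases y) auto
  then show thesis
    using that[of "mob 0 1 1 (- s)"] coordinate_mob[OF det] pole_at_mob[OF det] p by metis
qed

lemma finite_pole_at:
  assumes "coordinate u" shows "finite {x. pole_at u x}"
proof -
  obtain p where "\<And>x. pole_at u x \<Longrightarrow> x = p" using assms unfolding coordinate_def by blast
  then have "{x. pole_at u x} \<subseteq> {p}" by blast
  then show ?thesis using finite_subset by blast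
qed

lemma omega_eq:
  assumes "z2 \<noteq> z1"
  shows "omega z2 z1 = bidiff z2 z1"
proof -
  obtain u where u: "coordinate u" "\<not> pole_at u z1" "\<not> pole_at u z2"
    by (rule ex_coordinate_regular)
  have *: "1 / (u z2 - u z1)\<^sup>2 * du u z2 * du u z1 = bidiff z2 z1"
    if "coordinate u" "\<not> pole_at u z1" "\<not> pole_at u z2" for u
    using coordinate_bidiff[OF that(1,3,2) assms] by simp
  show ?thesis
    unfolding omega_def by (rule the_equality) (use u * in metis)+
qed

subsection \<open>Forms of the second kind\<close>

lemma chart_pt [simp]: "chart z (chart_pt z) = z"
  by (cases z) auto

lemma in_chart_pt [simp]: "in_chart \<alpha> z (chart_pt z) = \<alpha> z"
  by (cases z) auto

lemma inj_chart: "inj (chart z)"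
proof (cases z)
  case Infty
  show ?thesis
    unfolding inj_def Infty by (auto split: if_splits)
qed (auto simp: inj_def)

lemma eventually_chart_notin:
  assumes "finite Z"
  shows "\<forall>\<^sub>F w in at (chart_pt z). chart z w \<notin> Z"
proof -
  have "finite (chart z -` Z)" using assms inj_chart by (rule finite_vimageI)
  then have "\<forall>\<^sub>F w in at (chart_pt z). w \<notin> chart z -` Z"
    using islimpt_finite[of "chart z -` Z" "chart_pt z"] by (simp add: islimpt_iff_eventually)
  then show ?thesis by simp
qed

lemma in_chart_cong_finite:
  assumes "finite Z" "\<And>x. x \<notin> Z \<Longrightarrow> \<alpha> x = \<beta> x"
  shows "\<forall>\<^sub>F w in at (chart_pt z). in_chart \<alpha> z w = in_chart \<beta> z w"
proof -
  have "\<forall>\<^sub>F w in at (chart_pt z). chart z w \<notin> Z" "\<forall>\<^sub>F w in at (chart_pt z). w \<noteq> chart_pt z"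
    by (intro eventually_chart_notin assms) (simp add: eventually_at_filter)
  then show ?thesis
    by eventually_elim (cases z, use assms(2) in auto)
qed

lemma in_chart_lincomb:
  "in_chart (\<lambda>x. a * \<alpha> x + b * \<beta> x) z w = a * in_chart \<alpha> z w + b * in_chart \<beta> z w"
  by (cases z) (auto simp: field_simps)

lemma form_val_mero: "in_chart (form_val \<alpha>) z nicely_meromorphic_on {chart_pt z}"
  using form_val[of \<alpha>] by (simp add: mero_form_def)

lemma form_val_tendsto:
  assumes "form_regular \<alpha> z"
  shows "in_chart (form_val \<alpha>) z \<midarrow>chart_pt z\<rightarrow> form_val \<alpha> z"
  using assms form_val_mero[of \<alpha> z] unfolding nicely_meromorphic_on_def form_regular_def by simp

lemma form_val_nonregular:
  assumes "\<not> form_regular \<alpha> z"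
  shows "form_val \<alpha> z = 0"
proof -
  have "\<not> in_chart (form_val \<alpha>) z \<midarrow>chart_pt z\<rightarrow> form_val \<alpha> z"
    using not_tendsto_and_filterlim_at_infinity[OF trivial_limit_at] assms
    unfolding form_regular_def is_pole_def by blast
  then show ?thesis
    using form_val_mero[of \<alpha> z] unfolding nicely_meromorphic_on_def by simp
qed

text \<open>Regularity and the value at a regular point are determined by limits, hence by the
  values off a finite set; at a pole both values are the default \<open>0\<close>.\<close>

lemma form_eqI:
  assumes "finite Z" "\<And>x. x \<notin> Z \<Longrightarrow> form_val \<alpha> x = form_val \<beta> x"
  shows "\<alpha> = \<beta>"
proof -
  have "form_val \<alpha> z = form_val \<beta> z" for z
  proof -
    note ev = in_chart_cong_finite[of Z "form_val \<alpha>" "form_val \<beta>" z, OF assms]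
    have reg: "form_regular \<alpha> z \<longleftrightarrow> form_regular \<beta> z"
      unfolding form_regular_def using is_pole_cong[OF ev refl] by simp
    show ?thesis
    proof (cases "form_regular \<alpha> z")
      case True
      then have "in_chart (form_val \<beta>) z \<midarrow>chart_pt z\<rightarrow> form_val \<alpha> z"
        using form_val_tendsto[OF True] tendsto_cong[OF ev, of "form_val \<alpha> z"] by simp
      moreover have "in_chart (form_val \<beta>) z \<midarrow>chart_pt z\<rightarrow> form_val \<beta> z"
        using True reg by (intro form_val_tendsto) simp
      ultimately show ?thesis by (rule LIM_unique)
    next
      case False
      then show ?thesis using reg by (simp add: form_val_nonregular)
    qed
  qed
  then have "form_val \<alpha> = form_val \<beta>" by blast
  then show ?thesis by (simp add: form_val_inject)
qed

text \<open>The chain rule across charts. \<open>du u (chart z w)\<close> is taken in the chart of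
  the point \<open>chart z w\<close>, which for a finite point near infinity is not
  \<open>chart z\<close>. The factor \<open>- 1 / w^2\<close> between the charts then enters both
  the form and the derivative of \<open>u\<close>.\<close>

lemma in_chart_coordinate:
  assumes u: "coordinate u" and reg: "\<not> pole_at u (chart z w)"
  shows "in_chart \<alpha> z w = \<alpha> (chart z w) / du u (chart z w) * deriv (u \<circ> chart z) w"
proof -
  have nz: "du u (chart z w) \<noteq> 0" using du_nonzero[OF u reg] .
  show ?thesis
  proof (cases z)
    case (Aff t)
    have "u \<circ> chart z = u \<circ> chart (Aff w)" using Aff by auto
    then have "deriv (u \<circ> chart z) w = du u (Aff w)" by (simp add: du_def)
    then show ?thesis using nz Aff by simp
  next
    case Infty
    show ?thesis
    proof (cases "w = 0")
      case True
      then show ?thesis using nz Infty by (simp add: du_def)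
    next
      case False
      obtain a b c d where det: "a * d - b * c \<noteq> 0" and um: "u = mob a b c d"
        using u by (rule coordinate_imp_mob)
      have det': "b * c - a * d \<noteq> 0" using det by auto
      have gen: "- E / X\<^sup>2 = - (E / (X / w)\<^sup>2) / w\<^sup>2" for E X :: complex
        using False by (simp add: power_divide)
      have *: "c * (1 / w) + d = (d * w + c) / w" using False by (simp add: field_simps)
      have nz': "c * (1 / w) + d \<noteq> 0"
        using reg False Infty unfolding um pole_at_mob[OF det] by simp
      then have "d * w + c \<noteq> 0" using False unfolding * by simp
      then have "deriv (u \<circ> chart z) w = (b * c - a * d) / (d * w + c)\<^sup>2"
        unfolding um Infty mob_chart by (rule frac_linear_deriv[OF det'])
      moreover have "du u (chart z w) = (a * d - b * c) / (c * (1 / w) + d)\<^sup>2"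
        unfolding um using du_mob(1)[OF det nz'] False Infty by simp
      ultimately have "deriv (u \<circ> chart z) w = - du u (chart z w) / w\<^sup>2"
        unfolding * using gen[of "a * d - b * c" "d * w + c"] by (simp only: minus_diff_eq)
      then have "\<alpha> (chart z w) / du u (chart z w) * deriv (u \<circ> chart z) w = - \<alpha> (chart z w) / w\<^sup>2"
        using nz by (simp del: chart.simps)
      then show ?thesis using False Infty by simp
    qed
  qed
qed

section \<open>Rationality of forms in a coordinate\<close>

lemma finite_coordinate_vimage:
  assumes "coordinate u" "finite Z"
  shows "finite {x. u x \<in> Z}"
proof -
  have "inj_on u {x. \<not> pole_at u x \<and> u x \<in> Z}"
    using coordinate_inj[OF assms(1)] by (auto simp: inj_on_def)
  then have "finite {x. \<not> pole_at u x \<and> u x \<in> Z}"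
    by (rule inj_on_finite[of u _ Z]) (use assms(2) in auto)
  with finite_pole_at[OF assms(1)]
  have "finite ({x. pole_at u x} \<union> {x. \<not> pole_at u x \<and> u x \<in> Z})" by blast
  then show ?thesis by (rule finite_subset[rotated]) auto
qed

lemma form_rational_cofinite:
  assumes u: "coordinate u"
  obtains p q Z where "q \<noteq> 0" "finite Z"
    "\<And>x. x \<notin> Z \<Longrightarrow> form_val \<alpha> x = poly p (u x) / poly q (u x) * du u x"
proof -
  obtain a b c d where det: "a * d - b * c \<noteq> 0" and um: "u = mob a b c d"
    using u by (rule coordinate_imp_mob)
  define h where "h = (\<lambda>t. form_val \<alpha> (Aff t))"
  have "h meromorphic_on {t}" for t
  proof -
    have "in_chart (form_val \<alpha>) (Aff t) = h" by (auto simp: h_def)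
    then show ?thesis using form_val_mero[of \<alpha> "Aff t"] unfolding nicely_meromorphic_on_def by simp
  qed
  then have "h meromorphic_on UNIV"
    using meromorphic_on_meromorphic_at by blast
  moreover have "(\<lambda>w. h (1 / w)) meromorphic_on {0}"
  proof -
    have "in_chart (form_val \<alpha>) Infty meromorphic_on {0}"
      using form_val_mero[of \<alpha> Infty] unfolding nicely_meromorphic_on_def by simp
    then have "(\<lambda>w. - w\<^sup>2 * in_chart (form_val \<alpha>) Infty w) meromorphic_on {0}"
      by (intro meromorphic_intros)
    moreover have "\<forall>\<^sub>F w in at 0. - w\<^sup>2 * in_chart (form_val \<alpha>) Infty w = h (1 / w)"
      by (simp add: eventually_at_filter h_def)
    ultimately show ?thesis
      using meromorphic_on_cong[of "{0}" "\<lambda>w. - w\<^sup>2 * in_chart (form_val \<alpha>) Infty w" "\<lambda>w. h (1 / w)" "{0}"]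
      by simp
  qed
  ultimately have "rat_fun h" by (rule rat_fun_of_meromorphic)
  \<comment> \<open>Multiplying by the square of \<open>c * t + d\<close> and dividing by the
    determinant is division by \<open>du u (Aff t)\<close>: the coefficient of \<open>dt\<close>
    becomes that of \<open>du\<close>.\<close>
  then have "rat_fun (\<lambda>t. h t * poly [:d, c:] t * poly [:d, c:] t / (a * d - b * c))"
    by (intro rat_fun_divide rat_fun_mult rat_fun_poly rat_fun_const)
  then obtain P Q Z where "finite Z"
    and PQ: "\<And>t. t \<notin> Z \<Longrightarrow> h t * poly [:d, c:] t * poly [:d, c:] t / (a * d - b * c) = poly P t / poly Q t"
    unfolding rat_fun_def by blast
  \<comment> \<open>The inverse Moebius function, through which a rational function of
    \<open>t\<close> becomes one of \<open>u\<close>.\<close>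
  define M where "M = (\<lambda>y. poly [:- b, d:] y / poly [:a, - c:] y)"
  have M: "M (u (Aff t)) = t" if "c * t + d \<noteq> 0" for t
  proof -
    have "(a * t + b) / (c * t + d) * d - b = (a * d - b * c) * t / (c * t + d)"
      "a - (a * t + b) / (c * t + d) * c = (a * d - b * c) / (c * t + d)"
      using that by (simp_all add: divide_simps) (simp_all add: algebra_simps)
    then show ?thesis using that det by (simp add: M_def um)
  qed
  have "rat_fun M" unfolding M_def by (intro rat_fun_divide rat_fun_poly)
  then have "rat_fun (\<lambda>y. poly P (M y) / poly Q (M y))"
    by (intro rat_fun_divide rat_fun_poly_comp)
  then obtain p q Z' where q: "q \<noteq> 0" and "finite Z'"
    and pq: "\<And>y. y \<notin> Z' \<Longrightarrow> poly P (M y) / poly Q (M y) = poly p y / poly q y"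
    unfolding rat_fun_def by blast
  define Z'' where "Z'' = {Infty} \<union> Aff ` Z \<union> {x. pole_at u x} \<union> {x. u x \<in> Z'}"
  have "finite Z''"
    using \<open>finite Z\<close> \<open>finite Z'\<close> finite_pole_at[OF u] finite_coordinate_vimage[OF u]
    unfolding Z''_def by blast
  moreover have "form_val \<alpha> x = poly p (u x) / poly q (u x) * du u x" if x: "x \<notin> Z''" for x
  proof (cases x)
    case (Aff t)
    with x have t: "t \<notin> Z" "u x \<notin> Z'" and reg: "c * t + d \<noteq> 0"
      unfolding Z''_def using pole_at_mob[OF det] by (auto simp: um)
    have "poly p (u x) / poly q (u x) = h t * (c * t + d) * (c * t + d) / (a * d - b * c)"
      using PQ[OF t(1)] pq[OF t(2)] M[OF reg] Aff by (simp add: algebra_simps)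
    then show ?thesis
      using du_mob(1)[OF det reg] reg det Aff by (simp add: um h_def power2_eq_square)
  qed (use x in \<open>simp add: Z''_def\<close>)
  ultimately show thesis by (intro that[OF q])
qed

text \<open>A denominator of least degree leaves no common root: a common linear factor could be
  cancelled at the cost of finitely many more exceptional points.\<close>

lemma form_rational_reduced:
  assumes u: "coordinate u"
  obtains p q Z where "q \<noteq> 0" "finite Z"
    "\<And>x. x \<notin> Z \<Longrightarrow> form_val \<alpha> x = poly p (u x) / poly q (u x) * du u x"
    "\<And>y. poly p y = 0 \<Longrightarrow> poly q y \<noteq> 0"
proof -
  define R where "R = (\<lambda>(p, q). q \<noteq> 0 \<and> (\<exists>Z. finite Z \<and>
    (\<forall>x. x \<notin> Z \<longrightarrow> form_val \<alpha> x = poly p (u x) / poly q (u x) * du u x)))"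
  have "\<exists>pq. R pq"
  proof (rule form_rational_cofinite[OF u, of \<alpha>])
    fix p q Z
    assume "q \<noteq> 0" "finite Z"
      "\<And>x. x \<notin> Z \<Longrightarrow> form_val \<alpha> x = poly p (u x) / poly q (u x) * du u x"
    then have "R (p, q)" unfolding R_def by auto
    then show ?thesis ..
  qed
  then obtain pq where "R pq" and min: "\<And>pq'. R pq' \<Longrightarrow> degree (snd pq) \<le> degree (snd pq')"
    using ex_has_least_nat[of R _ "\<lambda>pq. degree (snd pq)"] by blast
  moreover obtain p q where pq: "pq = (p, q)" by (cases pq)
  ultimately obtain Z where q: "q \<noteq> 0" and Z: "finite Z"
    "\<And>x. x \<notin> Z \<Longrightarrow> form_val \<alpha> x = poly p (u x) / poly q (u x) * du u x"
    unfolding R_def by auto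
  have False if "poly p y = 0" "poly q y = 0" for y
  proof -
    obtain p' q' where p': "p = [:- y, 1:] * p'" and q': "q = [:- y, 1:] * q'"
      using \<open>poly p y = 0\<close> \<open>poly q y = 0\<close> unfolding poly_eq_0_iff_dvd by (auto elim!: dvdE)
    have "q' \<noteq> 0" using q q' by auto
    moreover have "finite (Z \<union> {x. u x \<in> {y}})"
      using Z finite_coordinate_vimage[OF u] by blast
    moreover have "form_val \<alpha> x = poly p' (u x) / poly q' (u x) * du u x"
      if "x \<notin> Z \<union> {x. u x \<in> {y}}" for x
    proof -
      have "u x - y \<noteq> 0" using that by simp
      moreover have "poly p (u x) = (u x - y) * poly p' (u x)" "poly q (u x) = (u x - y) * poly q' (u x)"
        unfolding p' q' by (simp_all add: algebra_simps)
      ultimately show ?thesis using Z(2)[of x] that by simp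
    qed
    ultimately have "R (p', q')" unfolding R_def by blast
    then have "degree q \<le> degree q'" using min pq by fastforce
    moreover have "degree q = 1 + degree q'"
      unfolding q' using \<open>q' \<noteq> 0\<close> by (subst degree_mult_eq) auto
    ultimately show False by simp
  qed
  then show thesis by (intro that[OF q Z]) blast+
qed

text \<open>For a reduced fraction the roots of \<open>q\<close> give exactly the poles: at a root,
  a finite limit of the form would force \<open>poly p (u x) * du u x = 0\<close>. Elsewhere the
  quotient is continuous, and the value of a form at a regular point is its limit.\<close>

lemma form_rational:
  assumes u: "coordinate u"
  obtains p q where "q \<noteq> 0"
    "\<And>x. \<not> pole_at u x \<Longrightarrow> form_regular \<alpha> x \<longleftrightarrow> poly q (u x) \<noteq> 0"
    "\<And>x. \<not> pole_at u x \<Longrightarrow> poly q (u x) \<noteq> 0 \<Longrightarrow> form_val \<alpha> x = poly p (u x) / poly q (u x) * du u x"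
proof -
  obtain p q Z where q: "q \<noteq> 0" and Z: "finite Z"
    "\<And>x. x \<notin> Z \<Longrightarrow> form_val \<alpha> x = poly p (u x) / poly q (u x) * du u x"
    and red: "\<And>y. poly p y = 0 \<Longrightarrow> poly q y \<noteq> 0"
    by (rule form_rational_reduced[OF u, of \<alpha>]) (rule that)
  have main: "(form_regular \<alpha> x \<longleftrightarrow> poly q (u x) \<noteq> 0) \<and>
      (poly q (u x) \<noteq> 0 \<longrightarrow> form_val \<alpha> x = poly p (u x) / poly q (u x) * du u x)"
    if x: "\<not> pole_at u x" for x
  proof -
    define U where "U = u \<circ> chart x"
    define z0 where "z0 = chart_pt x"
    have "U nicely_meromorphic_on {z0}"
      using u unfolding coordinate_def mero_fun_def U_def z0_def by blast
    then have U: "U analytic_on {z0}"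
      by (rule nicely_meromorphic_on_imp_analytic_at) (use x in \<open>auto simp: pole_at_def U_def z0_def\<close>)
    have Uz0: "U z0 = u x" "deriv U z0 = du u x"
      by (auto simp: U_def z0_def du_def)
    have UU: "U \<midarrow>z0\<rightarrow> u x" "deriv U \<midarrow>z0\<rightarrow> du u x"
      using analytic_at_imp_isCont[OF U] analytic_at_imp_isCont[OF analytic_deriv[OF U]] Uz0
      unfolding isCont_def by simp_all
    have lim: "(\<lambda>w. poly r (U w)) \<midarrow>z0\<rightarrow> poly r (u x)" for r
      using UU(1) by (rule tendsto_poly)
    define B where "B = Z \<union> {x. pole_at u x} \<union> {x. u x \<in> {y. poly q y = 0}}"
    have "finite B"
      using Z finite_pole_at[OF u] finite_coordinate_vimage[OF u poly_roots_finite[OF q]]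
      unfolding B_def by blast
    then have "\<forall>\<^sub>F w in at z0. chart x w \<notin> B"
      unfolding z0_def by (rule eventually_chart_notin)
    then have ev: "\<forall>\<^sub>F w in at z0. poly q (U w) \<noteq> 0 \<and>
        in_chart (form_val \<alpha>) x w = poly p (U w) / poly q (U w) * deriv U w"
    proof eventually_elim
      case (elim w)
      then have "\<not> pole_at u (chart x w)" "chart x w \<notin> Z" "poly q (U w) \<noteq> 0"
        by (auto simp: B_def U_def)
      then show ?case
        using in_chart_coordinate[OF u, of x w "form_val \<alpha>"] Z(2)[of "chart x w"]
          du_nonzero[OF u, of "chart x w"] by (simp add: U_def)
    qed
    show ?thesis
    proof (cases "poly q (u x) = 0")
      case True
      have "\<not> form_regular \<alpha> x"
      proof
        assume "form_regular \<alpha> x"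
        then have "(\<lambda>w. in_chart (form_val \<alpha>) x w * poly q (U w)) \<midarrow>z0\<rightarrow> form_val \<alpha> x * poly q (u x)"
          unfolding z0_def by (intro tendsto_mult form_val_tendsto lim[unfolded z0_def])
        moreover have "\<forall>\<^sub>F w in at z0. in_chart (form_val \<alpha>) x w * poly q (U w) = poly p (U w) * deriv U w"
          using ev by eventually_elim auto
        ultimately have "(\<lambda>w. poly p (U w) * deriv U w) \<midarrow>z0\<rightarrow> form_val \<alpha> x * poly q (u x)"
          by (rule Lim_transform_eventually)
        moreover have "(\<lambda>w. poly p (U w) * deriv U w) \<midarrow>z0\<rightarrow> poly p (u x) * du u x"
          by (intro tendsto_mult lim UU)
        ultimately have "poly p (u x) * du u x = form_val \<alpha> x * poly q (u x)"
          by (rule LIM_unique[symmetric])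
        then show False using True red[of "u x"] du_nonzero[OF u x] by auto
      qed
      with True show ?thesis by simp
    next
      case False
      have "(\<lambda>w. poly p (U w) / poly q (U w) * deriv U w) \<midarrow>z0\<rightarrow> poly p (u x) / poly q (u x) * du u x"
        by (intro tendsto_intros lim UU False)
      moreover have "\<forall>\<^sub>F w in at z0. poly p (U w) / poly q (U w) * deriv U w = in_chart (form_val \<alpha>) x w"
        using ev by eventually_elim auto
      ultimately have L: "in_chart (form_val \<alpha>) x \<midarrow>z0\<rightarrow> poly p (u x) / poly q (u x) * du u x"
        by (rule Lim_transform_eventually)
      then have "form_regular \<alpha> x"
        using not_tendsto_and_filterlim_at_infinity[OF trivial_limit_at]
        unfolding form_regular_def is_pole_def z0_def by blast
      moreover from this have "form_val \<alpha> x = poly p (u x) / poly q (u x) * du u x"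
        using LIM_unique[OF form_val_tendsto L[unfolded z0_def]] by simp
      ultimately show ?thesis using False by simp
    qed
  qed
  then show thesis using that[where p = p and q = q] q by simp
qed

lemma finite_nonregular: "finite {x. \<not> form_regular \<alpha> x}"
proof -
  obtain u where u: "coordinate u"
    using ex_coordinate_regular[of undefined undefined] by blast
  show ?thesis
  proof (rule form_rational[OF u, of \<alpha>])
    fix p q :: "complex poly"
    assume q: "q \<noteq> 0" "\<And>x. \<not> pole_at u x \<Longrightarrow> form_regular \<alpha> x \<longleftrightarrow> poly q (u x) \<noteq> 0"
    have "finite ({x. pole_at u x} \<union> {x. u x \<in> {y. poly q y = 0}})"
      using finite_pole_at[OF u] finite_coordinate_vimage[OF u poly_roots_finite[OF q(1)]] by blast
    then show ?thesis
      by (rule finite_subset[rotated]) (use q(2) in auto)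
  qed
qed

section \<open>Forms with a single double pole\<close>

text \<open>The shape of \<open>bidiff\<close> in every chart. At the root of the linear factor only
  the term of order -2 occurs, so the residue vanishes and the form is of the second kind.\<close>

lemma inverse_square_linear:
  fixes K c d w0 :: complex
  assumes "c \<noteq> 0 \<or> d \<noteq> 0"
  defines "f \<equiv> (\<lambda>w. K / (c * w + d)\<^sup>2)"
  shows "f nicely_meromorphic_on {w0}" "residue f w0 = 0" "c * w0 + d \<noteq> 0 \<Longrightarrow> \<not> is_pole f w0"
proof -
  have ana: "f analytic_on {w0}" if "c * w0 + d \<noteq> 0"
    unfolding f_def using that by (intro analytic_intros) auto
  have sq: "f = (\<lambda>w. (K / c\<^sup>2) / (w - w0) ^ 2)" and c: "c \<noteq> 0" if "c * w0 + d = 0"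
  proof -
    show "c \<noteq> 0" using assms(1) that by auto
    have "d = - (c * w0)" using that by (simp add: eq_neg_iff_add_eq_0 add.commute)
    then have "c * w + d = c * (w - w0)" for w by (simp add: algebra_simps)
    then show "f = (\<lambda>w. (K / c\<^sup>2) / (w - w0) ^ 2)" by (simp add: f_def power_mult_distrib)
  qed
  show "f nicely_meromorphic_on {w0}"
  proof (cases "c * w0 + d = 0")
    case True
    show ?thesis
    proof (cases "K = 0")
      case False
      have "is_pole f w0"
        unfolding sq[OF True]
        by (rule is_pole_basic[of _ UNIV]) (use False c[OF True] in auto)
      moreover have "f meromorphic_on {w0}"
        unfolding f_def by (intro meromorphic_intros)
      ultimately show ?thesis using True by (simp add: nicely_meromorphic_on_def f_def)
    qed (simp add: f_def nicely_meromorphic_on_const)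
  qed (intro analytic_on_imp_nicely_meromorphic_on ana)
  show "residue f w0 = 0"
  proof (cases "c * w0 + d = 0")
    case True
    have "residue (\<lambda>w. (K / c\<^sup>2) / (w - w0) ^ Suc 1) w0 = (deriv ^^ 1) (\<lambda>_. K / c\<^sup>2) w0 / fact 1"
      by (rule residue_holomorphic_over_power[of UNIV]) auto
    then show ?thesis unfolding sq[OF True] by (simp add: numeral_2_eq_2)
  next
    case False
    then obtain S where "open S" "w0 \<in> S" "f holomorphic_on S"
      using ana analytic_at by blast
    then show ?thesis by (intro residue_holo)
  qed
  show "c * w0 + d \<noteq> 0 \<Longrightarrow> \<not> is_pole f w0"
    using ana analytic_at_imp_no_pole by blast
qed

text \<open>The four pairs of charts. At infinity the factor \<open>- 1 / w^2\<close> of the change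
  of chart combines with the square of \<open>1 / w - a\<close> into the square of a linear
  function.\<close>

lemma in_chart_bidiff:
  obtains K c d where "in_chart (\<lambda>x. k * bidiff x z) y = (\<lambda>w. K / (c * w + d)\<^sup>2)"
    "c \<noteq> 0 \<or> d \<noteq> 0" "c * chart_pt y + d = 0 \<longleftrightarrow> y = z"
proof (cases y; cases z)
  fix s a assume "y = Aff s" "z = Aff a"
  then show thesis by (intro that[of k 1 "- a"]) auto
next
  fix a assume "y = Infty" "z = Aff a"
  moreover have "- (k * (1 / (1 / w - a)\<^sup>2)) / w\<^sup>2 = - k / (- a * w + 1)\<^sup>2" if "w \<noteq> 0" for w
  proof -
    have "- a * w + 1 = (1 / w - a) * w" using that by (simp add: field_simps)
    then show ?thesis by (simp add: power_mult_distrib)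
  qed
  ultimately show thesis by (intro that[of "- k" "- a" 1]) (auto simp: fun_eq_iff)
next
  fix s assume "y = Aff s" "z = Infty"
  then show thesis by (intro that[of "- k" 0 1]) auto
next
  assume "y = Infty" "z = Infty"
  then show thesis by (intro that[of k 1 0]) auto
qed

text \<open>The scalar is kept inside the form: \<open>k = - 1\<close> gives
  \<open>e_form z\<close>, and \<open>k = - 1 / du u z\<close> gives it trivialised by the
  coordinate \<open>u\<close>.\<close>

definition bidiff_form :: "complex \<Rightarrow> pline \<Rightarrow> form2" where
  "bidiff_form k z = Abs_form2 (\<lambda>x. k * bidiff x z)"

lemma form_val_bidiff_form: "form_val (bidiff_form k z) = (\<lambda>x. k * bidiff x z)"
  unfolding bidiff_form_def
proof (rule Abs_form2_inverse)
  have "in_chart (\<lambda>x. k * bidiff x z) y nicely_meromorphic_on {chart_pt y} \<and>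
      residue (in_chart (\<lambda>x. k * bidiff x z) y) (chart_pt y) = 0" for y
    by (rule in_chart_bidiff[of k z y]) (simp add: inverse_square_linear)
  then show "(\<lambda>x. k * bidiff x z) \<in>
      {\<alpha>. mero_form \<alpha> \<and> (\<forall>z. residue (in_chart \<alpha> z) (chart_pt z) = 0)}"
    by (simp add: mero_form_def)
qed

lemma form_regular_bidiff_form: "x \<noteq> z \<Longrightarrow> form_regular (bidiff_form k z) x"
  unfolding form_regular_def form_val_bidiff_form
  by (rule in_chart_bidiff[of k z x]) (simp add: inverse_square_linear)

lemma e_form_eq: "e_form z = bidiff_form (-1) z"
proof -
  have ok: "form_val (bidiff_form (-1) z) x = - du u x / (u x - u z)\<^sup>2 * du u z"
    if "coordinate u" "\<not> pole_at u z" "x \<noteq> z" "\<not> pole_at u x" for u x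
    using coordinate_bidiff[OF that(1,4,2,3)] by (simp add: form_val_bidiff_form)
  show ?thesis
    unfolding e_form_def
  proof (rule the_equality)
    fix \<gamma>
    assume \<gamma>: "\<forall>u. coordinate u \<longrightarrow> \<not> pole_at u z \<longrightarrow> (\<forall>x. x \<noteq> z \<longrightarrow> \<not> pole_at u x \<longrightarrow>
      form_val \<gamma> x = - du u x / (u x - u z)\<^sup>2 * du u z)"
    show "\<gamma> = bidiff_form (-1) z"
    proof (rule form_eqI[of "{z}"])
      fix x assume "x \<notin> {z}"
      moreover obtain u where "coordinate u" "\<not> pole_at u x" "\<not> pole_at u z"
        by (rule ex_coordinate_regular)
      ultimately show "form_val \<gamma> x = form_val (bidiff_form (-1) z) x"
        using \<gamma> ok by (metis singletonI)
    qed simp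
  qed (use ok in blast)
qed

text \<open>The constant term of the Laurent expansion is a linear functional on all forms that extends
  evaluation from the forms regular at \<open>z\<close>. The values of \<open>form_val\<close> do not depend linearly on the
  form when there are poles.\<close>

definition const_term :: "pline \<Rightarrow> form2 \<Rightarrow> complex" where
  "const_term z \<alpha> = residue (\<lambda>w. in_chart (form_val \<alpha>) z w / (w - chart_pt z)) (chart_pt z)"

lemma const_term_regular:
  assumes "form_regular \<alpha> z"
  shows "const_term z \<alpha> = form_val \<alpha> z"
proof -
  have "in_chart (form_val \<alpha>) z analytic_on {chart_pt z}"
    using assms form_val_mero[of \<alpha> z] unfolding form_regular_def
    by (intro nicely_meromorphic_on_imp_analytic_at) auto
  then obtain S where "open S" "chart_pt z \<in> S" "in_chart (form_val \<alpha>) z holomorphic_on S"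
    using analytic_at by blast
  then show ?thesis unfolding const_term_def by (subst residue_simple) auto
qed

text \<open>The relation constrains values only where both forms are regular. As this excludes
  finitely many points, it holds in a punctured neighbourhood of \<open>z\<close> even when
  \<open>z\<close> is a pole, and a residue depends on nothing else.\<close>

lemma const_term_lincomb:
  assumes "is_lincomb \<gamma> a \<alpha> b \<beta>"
  shows "const_term z \<gamma> = a * const_term z \<alpha> + b * const_term z \<beta>"
proof -
  let ?z = "chart_pt z"
  define f where "f = (\<lambda>\<alpha> w. in_chart (form_val \<alpha>) z w / (w - ?z))"
  have "\<exists>r>0. f \<alpha> holomorphic_on ball ?z r - {?z}" for \<alpha>
  proof -
    have "isolated_singularity_at (in_chart (form_val \<alpha>) z) ?z"
      using form_val_mero[of \<alpha> z] unfolding nicely_meromorphic_on_def meromorphic_at_iff by blast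
    then obtain r where r: "r > 0" "in_chart (form_val \<alpha>) z analytic_on ball ?z r - {?z}"
      by (auto simp: isolated_singularity_at_def)
    then show ?thesis
      unfolding f_def
      by (intro exI[of _ r] conjI holomorphic_on_divide analytic_imp_holomorphic[OF r(2)] holomorphic_intros r(1))
        auto
  qed
  then obtain r s where rs: "r > 0" "s > 0"
      and "f \<alpha> holomorphic_on ball ?z r - {?z}" "f \<beta> holomorphic_on ball ?z s - {?z}"
    by metis
  then have hol: "f \<alpha> holomorphic_on ball ?z (min r s) - {?z}" "f \<beta> holomorphic_on ball ?z (min r s) - {?z}"
    by (auto elim!: holomorphic_on_subset)
  have ball: "open (ball ?z (min r s))" "?z \<in> ball ?z (min r s)" using rs by auto
  have "finite ({x. \<not> form_regular \<alpha> x} \<union> {x. \<not> form_regular \<beta> x})"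
    by (simp add: finite_nonregular)
  then have "\<forall>\<^sub>F w in at ?z. in_chart (form_val \<gamma>) z w =
      in_chart (\<lambda>x. a * form_val \<alpha> x + b * form_val \<beta> x) z w"
    by (rule in_chart_cong_finite) (use assms in \<open>auto simp: is_lincomb_def\<close>)
  then have "\<forall>\<^sub>F w in at ?z. f \<gamma> w = a * f \<alpha> w + b * f \<beta> w"
    by eventually_elim (simp add: f_def in_chart_lincomb add_divide_distrib)
  then have "residue (f \<gamma>) ?z = residue (\<lambda>w. a * f \<alpha> w + b * f \<beta> w) ?z"
    by (rule residue_cong) simp
  also have "\<dots> = residue (\<lambda>w. a * f \<alpha> w) ?z + residue (\<lambda>w. b * f \<beta> w) ?z"
    by (rule residue_add[OF ball]) (intro holomorphic_intros hol)+
  also have "\<dots> = a * residue (f \<alpha>) ?z + b * residue (f \<beta>) ?z"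
    by (simp only: residue_lmul[OF ball hol(1)] residue_lmul[OF ball hol(2)])
  finally show ?thesis by (simp add: const_term_def f_def)
qed

lemma bidiff_form_lincomb: "is_lincomb (bidiff_form (k * l) z) k (bidiff_form l z) 0 \<beta>"
  by (simp add: is_lincomb_def form_val_bidiff_form)

subsection \<open>Derivations of the symmetric algebra\<close>

text \<open>The sum runs over the multiset with multiplicities, which yields the factor
  \<open>n\<close> in the derivative of an \<open>n\<close>-th power.\<close>

definition mderiv :: "(form2 \<Rightarrow> complex) \<Rightarrow> form2 multiset \<Rightarrow> free_alg" where
  "mderiv l M = (\<Sum>\<alpha>\<in>#M. Poly_Mapping.single (M - {#\<alpha>#}) (l \<alpha>))"

definition fderiv :: "(form2 \<Rightarrow> complex) \<Rightarrow> free_alg \<Rightarrow> free_alg" where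
  "fderiv l p = (\<Sum>M\<in>Poly_Mapping.keys p. fcst (Poly_Mapping.lookup p M) * mderiv l M)"

lemma fcst_0 [simp]: "fcst 0 = 0"
  and fcst_1: "fcst 1 = 1"
  and fcst_add: "fcst (a + b) = fcst a + fcst b"
  and fcst_mult: "fcst (a * b) = fcst a * fcst b"
  by (simp_all add: fcst_def single_add mult_single flip: single_one zero_multiset_def)

lemma mderiv_add:
  "mderiv l (M + N) = mderiv l M * Poly_Mapping.single N 1 + Poly_Mapping.single M 1 * mderiv l N"
proof -
  have 1: "(\<Sum>\<alpha>\<in>#M. Poly_Mapping.single (M + N - {#\<alpha>#}) (l \<alpha>)) = mderiv l M * Poly_Mapping.single N 1"
    for M N
    unfolding mderiv_def sum_mset_distrib_right
    by (intro arg_cong[of _ _ sum_mset] image_mset_cong) (simp add: mult_single)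
  have "mderiv l (M + N) = (\<Sum>\<alpha>\<in>#M. Poly_Mapping.single (M + N - {#\<alpha>#}) (l \<alpha>))
      + (\<Sum>\<alpha>\<in>#N. Poly_Mapping.single (N + M - {#\<alpha>#}) (l \<alpha>))"
    unfolding add.commute[of N M] by (simp add: mderiv_def)
  then show ?thesis unfolding 1 by (simp only: mult.commute)
qed

lemma fderiv_superset:
  assumes "finite S" "Poly_Mapping.keys p \<subseteq> S"
  shows "fderiv l p = (\<Sum>M\<in>S. fcst (Poly_Mapping.lookup p M) * mderiv l M)"
  unfolding fderiv_def
  by (intro sum.mono_neutral_left assms) (auto simp: in_keys_iff)

lemma fderiv_add: "fderiv l (p + q) = fderiv l p + fderiv l q"
proof -
  let ?S = "Poly_Mapping.keys p \<union> Poly_Mapping.keys q"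
  have "Poly_Mapping.keys (p + q) \<subseteq> ?S" by (rule Poly_Mapping.keys_add)
  then show ?thesis
    by (subst (1 2 3) fderiv_superset[of ?S])
      (auto simp: lookup_add fcst_add distrib_right sum.distrib)
qed

lemma fderiv_0 [simp]: "fderiv l 0 = 0"
  by (simp add: fderiv_def)

lemma fderiv_diff: "fderiv l (p - q) = fderiv l p - fderiv l q"
  using fderiv_add[of l "p - q" q] by simp

lemma fderiv_single: "fderiv l (Poly_Mapping.single M c) = fcst c * mderiv l M"
  by (subst fderiv_superset[of "{M}"]) (auto simp: lookup_single)

lemma sum_single_keys: "(\<Sum>M\<in>Poly_Mapping.keys p. Poly_Mapping.single M (Poly_Mapping.lookup p M)) = p"
proof (rule poly_mapping_eqI)
  fix N
  have "(\<Sum>M\<in>Poly_Mapping.keys p. if M = N then Poly_Mapping.lookup p M else 0)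
      = (if N \<in> Poly_Mapping.keys p then Poly_Mapping.lookup p N else 0)"
    by (rule sum.delta) simp
  also have "\<dots> = Poly_Mapping.lookup p N"
    by (simp add: in_keys_iff)
  finally show "Poly_Mapping.lookup (\<Sum>M\<in>Poly_Mapping.keys p. Poly_Mapping.single M (Poly_Mapping.lookup p M)) N
      = Poly_Mapping.lookup p N"
    unfolding lookup_sum lookup_single when_def .
qed

lemma free_alg_induct [case_names single add]:
  fixes P :: "free_alg \<Rightarrow> bool"
  assumes single: "\<And>M c. P (Poly_Mapping.single M c)" and add: "\<And>p q. P p \<Longrightarrow> P q \<Longrightarrow> P (p + q)"
  shows "P p"
proof -
  have "P (\<Sum>M\<in>S. Poly_Mapping.single M (Poly_Mapping.lookup p M))" for S
  proof (induction S rule: infinite_finite_induct)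
    case (insert M S)
    then show ?case by (simp add: add single)
  qed (use single[of "{#}" 0] in simp_all)
  from this[of "Poly_Mapping.keys p"] show ?thesis by (simp add: sum_single_keys)
qed

lemma fderiv_mult: "fderiv l (p * q) = fderiv l p * q + p * fderiv l q"
proof -
  have aux: "c * d * (m * N + M * n) = c * m * (d * N) + c * M * (d * n)" for c d m n M N :: free_alg
    by (simp only: distrib_left mult.assoc mult.left_commute mult.commute)
  have single: "Poly_Mapping.single M c = fcst c * Poly_Mapping.single M 1" for M c
    by (simp only: fcst_def mult_single mult_1_right empty_neutral)
  have 1: "fderiv l (Poly_Mapping.single M c * Poly_Mapping.single N d) =
      fderiv l (Poly_Mapping.single M c) * Poly_Mapping.single N d
      + Poly_Mapping.single M c * fderiv l (Poly_Mapping.single N d)" for M N c d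
    unfolding mult_single fderiv_single mderiv_add fcst_mult
    unfolding single[of M c] single[of N d] by (rule aux)
  show ?thesis
  proof (induction p rule: free_alg_induct)
    case (single M c)
    show ?case
      by (induction q rule: free_alg_induct) (auto simp: 1 fderiv_add distrib_left)
  qed (auto simp: fderiv_add distrib_right)
qed

lemma fderiv_fgen: "fderiv l (fgen \<alpha>) = fcst (l \<alpha>)"
  by (simp add: fgen_def fderiv_single mderiv_def fcst_1) (simp add: fcst_def)

lemma fderiv_fcst: "fderiv l (fcst c) = 0"
  unfolding fcst_def[of c] by (simp add: fderiv_single mderiv_def)

text \<open>A functional that respects the linear relations makes the derivation kill the generators
  \<open>g\<close> of the ideal. By the Leibniz rule \<open>r * g\<close> is sent to
  \<open>fderiv l r * g\<close>, again in the ideal.\<close>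

lemma fderiv_lin_ideal:
  assumes l: "\<And>\<gamma> a \<alpha> b \<beta>. is_lincomb \<gamma> a \<alpha> b \<beta> \<Longrightarrow> l \<gamma> = a * l \<alpha> + b * l \<beta>"
    and p: "p \<in> lin_ideal"
  shows "fderiv l p \<in> lin_ideal"
  using p[unfolded lin_ideal_def]
proof (induction rule: free_alg.span_induct_alt)
  case base
  then show ?case by (simp add: lin_ideal_zero)
next
  case (step r g p)
  then obtain \<gamma> a \<alpha> b \<beta> where g: "g = fgen \<gamma> - fcst a * fgen \<alpha> - fcst b * fgen \<beta>"
    and "is_lincomb \<gamma> a \<alpha> b \<beta>" by blast
  then have "fderiv l g = 0"
    by (simp add: fderiv_diff fderiv_mult fderiv_fgen fderiv_fcst l fcst_add fcst_mult)
  moreover have "g \<in> lin_ideal"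
    unfolding lin_ideal_def using step by (intro free_alg.span_base) blast
  ultimately show ?case
    using step by (simp add: fderiv_add fderiv_mult lin_ideal_add lin_ideal_mult)
qed

text \<open>Defined on the whole of \<open>W\<close>, so that the rules of a derivation hold for
  arbitrary elements. Membership in \<open>W_at\<close> matters only when \<open>i_field\<close> is
  exchanged for it.\<close>

lift_definition W_deriv :: "pline \<Rightarrow> W \<Rightarrow> W" is "\<lambda>z. fderiv (\<lambda>\<alpha>. - const_term z \<alpha>)"
proof -
  fix z p q assume "p - q \<in> lin_ideal"
  then have "fderiv (\<lambda>\<alpha>. - const_term z \<alpha>) (p - q) \<in> lin_ideal"
    by (rule fderiv_lin_ideal[rotated]) (simp add: const_term_lincomb)
  then show "fderiv (\<lambda>\<alpha>. - const_term z \<alpha>) p - fderiv (\<lambda>\<alpha>. - const_term z \<alpha>) q \<in> lin_ideal"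
    by (simp add: fderiv_diff)
qed

lemma cst_1 [simp]: "cst 1 = 1"
  by (simp add: cst_def fcst_1 one_W_def)

lemma cst_0 [simp]: "cst 0 = 0"
  by (simp add: cst_def zero_W_def)

lemma cst_add: "cst (a + b) = cst a + cst b"
  by (simp add: cst_def fcst_add plus_W.abs_eq)

lemma cst_mult: "cst (a * b) = cst a * cst b"
  by (simp add: cst_def fcst_mult times_W.abs_eq)

lemma W_deriv_add: "W_deriv z (x + y) = W_deriv z x + W_deriv z y"
  by transfer (simp add: fderiv_add lin_ideal_zero)

lemma W_deriv_mult: "W_deriv z (x * y) = W_deriv z x * y + x * W_deriv z y"
  by transfer (simp add: fderiv_mult lin_ideal_zero)

lemma W_deriv_cst [simp]: "W_deriv z (cst c) = 0"
  by (simp add: cst_def W_deriv.abs_eq fderiv_fcst zero_W_def)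

lemma W_deriv_iota: "W_deriv z (iota \<alpha>) = cst (- const_term z \<alpha>)"
  by (simp add: cst_def iota_def W_deriv.abs_eq fderiv_fgen)

lemma iota_lincomb:
  assumes "is_lincomb \<gamma> a \<alpha> b \<beta>"
  shows "iota \<gamma> = cst a * iota \<alpha> + cst b * iota \<beta>"
proof -
  have "fgen \<gamma> - fcst a * fgen \<alpha> - fcst b * fgen \<beta> \<in> lin_ideal"
    unfolding lin_ideal_def using assms by (intro free_alg.span_base) blast
  then show ?thesis
    by (simp add: iota_def cst_def times_W.abs_eq plus_W.abs_eq W.abs_eq_iff algebra_simps)
qed

lemma iota_bidiff_form: "iota (bidiff_form (k * l) z) = cst k * iota (bidiff_form l z)"
  using iota_lincomb[OF bidiff_form_lincomb] by simp

section \<open>The field \<open>i\<close> as a restricted derivation\<close>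

lemma one_in_W_at: "1 \<in> W_at z"
  using W_at.cst[of 1] by simp

text \<open>Generators are sent to scalars, so the subalgebra of any point \<open>y\<close> is
  stable under the derivation at any \<open>z\<close>. For \<open>y = z\<close> this lets
  \<open>i_field\<close> be iterated; for different points it helps to place \<open>T_field\<close>
  in the domain of the second field.\<close>

lemma W_deriv_in_W_at:
  assumes "x \<in> W_at y"
  shows "W_deriv z x \<in> W_at y"
  using assms
proof induction
  case (cst c)
  then show ?case using W_at.cst[of 0] by simp
qed (auto simp: W_deriv_iota W_deriv_add W_deriv_mult intro: W_at.intros)

text \<open>An element involves finitely many forms, each with finitely many poles. This provides
  the Zariski neighbourhood on which the fields act.\<close>

lemma finite_not_in_W_at:
  assumes "v \<in> W_at y"
  shows "finite {z. v \<notin> W_at z}"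
  using assms
proof induction
  case (cst c)
  then show ?case by (simp add: W_at.cst)
next
  case (iota \<alpha>)
  show ?case
    by (rule finite_subset[OF _ finite_nonregular[of \<alpha>]]) (auto intro: W_at.iota)
next
  case (add x y)
  then have "finite ({z. x \<notin> W_at z} \<union> {z. y \<notin> W_at z})" by blast
  then show ?case by (rule finite_subset[rotated]) (auto intro: W_at.add)
next
  case (mult x y)
  then have "finite ({z. x \<notin> W_at z} \<union> {z. y \<notin> W_at z})" by blast
  then show ?case by (rule finite_subset[rotated]) (auto intro: W_at.mult)
qed

text \<open>Scalars and regular forms generate \<open>W_at z\<close>, so the conditions determine
  \<open>D\<close> there. The restriction of \<open>W_deriv z\<close> satisfies them because the
  constant term of a regular form is its value.\<close>

lemma i_field_eq: "i_field z = (\<lambda>x. if x \<in> W_at z then W_deriv z x else 0)"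
  unfolding i_field_def
proof (rule the_equality)
  fix D
  assume D: "(\<forall>x\<in>W_at z. \<forall>y\<in>W_at z. D (x + y) = D x + D y) \<and>
     (\<forall>c. \<forall>x\<in>W_at z. D (cst c * x) = cst c * D x) \<and>
     (\<forall>x\<in>W_at z. \<forall>y\<in>W_at z. D (x * y) = D x * y + x * D y) \<and>
     D 1 = 0 \<and>
     (\<forall>\<alpha>. form_regular \<alpha> z \<longrightarrow> D (iota \<alpha>) = cst (- form_val \<alpha> z)) \<and>
     (\<forall>x. x \<notin> W_at z \<longrightarrow> D x = 0)"
  have "D x = W_deriv z x" if "x \<in> W_at z" for x
    using that
  proof induction
    case (cst c)
    \<comment> \<open>A scalar is a multiple of \<open>1\<close>, which \<open>D\<close>
      kills.\<close>
    have "D (cst c * 1) = cst c * D 1" using D one_in_W_at by blast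
    then show ?case using D by simp
  qed (use D in \<open>auto simp: W_deriv_iota const_term_regular W_deriv_add W_deriv_mult\<close>)
  then show "D = (\<lambda>x. if x \<in> W_at z then W_deriv z x else 0)"
    using D by auto
next
  show "(\<forall>x\<in>W_at z. \<forall>y\<in>W_at z. (if x + y \<in> W_at z then W_deriv z (x + y) else 0) =
        (if x \<in> W_at z then W_deriv z x else 0) + (if y \<in> W_at z then W_deriv z y else 0)) \<and>
     (\<forall>c. \<forall>x\<in>W_at z. (if cst c * x \<in> W_at z then W_deriv z (cst c * x) else 0) =
        cst c * (if x \<in> W_at z then W_deriv z x else 0)) \<and>
     (\<forall>x\<in>W_at z. \<forall>y\<in>W_at z. (if x * y \<in> W_at z then W_deriv z (x * y) else 0) =
        (if x \<in> W_at z then W_deriv z x else 0) * y + x * (if y \<in> W_at z then W_deriv z y else 0)) \<and>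
     (if 1 \<in> W_at z then W_deriv z 1 else 0) = 0 \<and>
     (\<forall>\<alpha>. form_regular \<alpha> z \<longrightarrow>
        (if iota \<alpha> \<in> W_at z then W_deriv z (iota \<alpha>) else 0) = cst (- form_val \<alpha> z)) \<and>
     (\<forall>x. x \<notin> W_at z \<longrightarrow> (if x \<in> W_at z then W_deriv z x else 0) = 0)"
    using W_deriv_cst[of z 1]
    by (auto simp: W_deriv_iota const_term_regular W_deriv_add W_deriv_mult
        simp del: W_deriv_cst intro: W_at.intros)
      (simp_all add: W_at.intros)
qed

text \<open>The source of the commutator of \<open>i\<close> with multiplication by
  \<open>e\<close>: the minus sign in \<open>i\<close> cancels the one in
  \<open>e_form\<close>.\<close>

lemma W_deriv_e_form: "z2 \<noteq> z1 \<Longrightarrow> W_deriv z2 (iota (e_form z1)) = cst (omega z2 z1)"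
  by (simp add: W_deriv_iota const_term_regular e_form_eq form_regular_bidiff_form
      form_val_bidiff_form omega_eq)

lemma iota_e_form_in_W_at: "z2 \<noteq> z1 \<Longrightarrow> iota (e_form z1) \<in> W_at z2"
  by (simp add: e_form_eq form_regular_bidiff_form W_at.iota)

subsection \<open>Families depending rationally on a point\<close>

lemma polyfun_poly: "i < n \<Longrightarrow> polyfun n (\<lambda>x. poly p (x i))"
proof (induction p)
  case 0
  then show ?case using polyfun.const[of n 0] by simp
next
  case (pCons a p)
  then show ?case by (simp add: polyfun.intros)
qed

lemma polyfun_on_line:
  assumes "polyfun n f"
  shows "\<exists>p. \<forall>t. f (\<lambda>i. a i + t * b i) = poly p t"
  using assms
proof induction
  case (const c)
  then show ?case by (intro exI[of _ "[:c:]"]) simp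
next
  case (var i)
  then show ?case by (intro exI[of _ "[:a i, b i:]"]) simp
next
  case (add f g)
  then obtain p q where "\<forall>t. f (\<lambda>i. a i + t * b i) = poly p t" "\<forall>t. g (\<lambda>i. a i + t * b i) = poly q t"
    by blast
  then show ?case by (intro exI[of _ "p + q"]) simp
next
  case (mult f g)
  then obtain p q where "\<forall>t. f (\<lambda>i. a i + t * b i) = poly p t" "\<forall>t. g (\<lambda>i. a i + t * b i) = poly q t"
    by blast
  then show ?case by (intro exI[of _ "p * q"]) simp
qed

text \<open>On the line joining the two witnesses both factors become nonzero polynomials in one
  variable, and so does their product. This keeps common denominators from vanishing identically
  over \<open>z1\<close>.\<close>

lemma polyfun_mult_not_identically_zero:
  assumes "polyfun n f" "polyfun n g" "f (x(m := s)) \<noteq> 0" "g (y(m := s)) \<noteq> 0"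
  obtains w where "f (w(m := s)) * g (w(m := s)) \<noteq> 0"
proof -
  define a where "a = x(m := s)"
  define b where "b = (\<lambda>i. (y(m := s)) i - a i)"
  obtain p where p: "\<And>t. f (\<lambda>i. a i + t * b i) = poly p t"
    using polyfun_on_line[OF assms(1), of a b] by blast
  obtain q where q: "\<And>t. g (\<lambda>i. a i + t * b i) = poly q t"
    using polyfun_on_line[OF assms(2), of a b] by blast
  have line: "(\<lambda>i. a i + 0 * b i) = x(m := s)" "(\<lambda>i. a i + 1 * b i) = y(m := s)"
    by (auto simp: fun_eq_iff a_def b_def)
  have "poly p 0 \<noteq> 0" using p[of 0] assms(3) unfolding line by metis
  moreover have "poly q 1 \<noteq> 0" using q[of 1] assms(4) unfolding line by metis
  ultimately have "p * q \<noteq> 0" by auto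
  then obtain t where t: "poly (p * q) t \<noteq> 0" using poly_all_0_iff_0 by blast
  \<comment> \<open>Both end points have the entry \<open>s\<close> at \<open>m\<close>, so
    \<open>b m = 0\<close> and the whole line keeps this entry.\<close>
  have "(\<lambda>i. a i + t * b i)(m := s) = (\<lambda>i. a i + t * b i)"
    by (auto simp: fun_eq_iff a_def b_def)
  then show thesis using that[of "\<lambda>i. a i + t * b i"] t p q by simp
qed

text \<open>All but finitely many points, and \<open>a\<close> itself. With \<open>a = z1\<close>
  this is what \<open>W_tendsto\<close> requires of a fraction; as a filter it lets facts at generic
  points and at \<open>z1\<close> be combined in one step.\<close>

abbreviation cofinite_with :: "'a \<Rightarrow> 'a filter" where
  "cofinite_with a \<equiv> sup cofinite (principal {a})"

lemma eventually_cofinite_with: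
  "eventually P (cofinite_with a) \<longleftrightarrow> finite {z. \<not> P z} \<and> P a"
  by (simp add: eventually_sup eventually_cofinite eventually_principal)

definition rational_in :: "(pline \<Rightarrow> complex) \<Rightarrow> pline \<Rightarrow> nat \<Rightarrow> ((nat \<Rightarrow> pline) \<Rightarrow> pline \<Rightarrow> complex) \<Rightarrow> bool" where
  "rational_in u z1 m f \<longleftrightarrow> (\<exists>P Q. polyfun (Suc m) P \<and> polyfun (Suc m) Q \<and>
     (\<exists>x. Q (x(m := u z1)) \<noteq> 0) \<and>
     (\<forall>\<^sub>F z in cofinite_with z1. \<forall>p. (\<forall>i<m. \<not> pole_at u (p i)) \<longrightarrow>
        Q ((\<lambda>i. u (p i))(m := u z)) \<noteq> 0 \<longrightarrow>
        f p z = P ((\<lambda>i. u (p i))(m := u z)) / Q ((\<lambda>i. u (p i))(m := u z))))"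

lemma rational_in_const: "rational_in u z1 m (\<lambda>p z. c)"
  unfolding rational_in_def
  by (intro exI[of _ "\<lambda>_. c"] exI[of _ "\<lambda>_. 1"]) (simp add: polyfun.const)

lemma rational_in_add_mult:
  assumes "rational_in u z1 m f" "rational_in u z1 m g"
  shows "rational_in u z1 m (\<lambda>p z. f p z + g p z)" "rational_in u z1 m (\<lambda>p z. f p z * g p z)"
proof -
  obtain P Q x where PQ: "polyfun (Suc m) P" "polyfun (Suc m) Q" "Q (x(m := u z1)) \<noteq> 0"
    and f: "\<forall>\<^sub>F z in cofinite_with z1. \<forall>p. (\<forall>i<m. \<not> pole_at u (p i)) \<longrightarrow>
        Q ((\<lambda>i. u (p i))(m := u z)) \<noteq> 0 \<longrightarrow>
        f p z = P ((\<lambda>i. u (p i))(m := u z)) / Q ((\<lambda>i. u (p i))(m := u z))"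
    using assms(1) unfolding rational_in_def by blast
  obtain R S y where RS: "polyfun (Suc m) R" "polyfun (Suc m) S" "S (y(m := u z1)) \<noteq> 0"
    and g: "\<forall>\<^sub>F z in cofinite_with z1. \<forall>p. (\<forall>i<m. \<not> pole_at u (p i)) \<longrightarrow>
        S ((\<lambda>i. u (p i))(m := u z)) \<noteq> 0 \<longrightarrow>
        g p z = R ((\<lambda>i. u (p i))(m := u z)) / S ((\<lambda>i. u (p i))(m := u z))"
    using assms(2) unfolding rational_in_def by blast
  obtain w where w: "Q (w(m := u z1)) * S (w(m := u z1)) \<noteq> 0"
    using polyfun_mult_not_identically_zero[OF PQ(2) RS(2) PQ(3) RS(3)] .
  show "rational_in u z1 m (\<lambda>p z. f p z * g p z)"
    unfolding rational_in_def
  proof (intro exI conjI)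
    show "polyfun (Suc m) (\<lambda>x. P x * R x)" "polyfun (Suc m) (\<lambda>x. Q x * S x)"
      by (intro polyfun.mult PQ RS)+
    show "\<forall>\<^sub>F z in cofinite_with z1. \<forall>p. (\<forall>i<m. \<not> pole_at u (p i)) \<longrightarrow>
        Q ((\<lambda>i. u (p i))(m := u z)) * S ((\<lambda>i. u (p i))(m := u z)) \<noteq> 0 \<longrightarrow>
        f p z * g p z = P ((\<lambda>i. u (p i))(m := u z)) * R ((\<lambda>i. u (p i))(m := u z)) /
          (Q ((\<lambda>i. u (p i))(m := u z)) * S ((\<lambda>i. u (p i))(m := u z)))"
      using f g by eventually_elim simp
  qed (fact w)
  show "rational_in u z1 m (\<lambda>p z. f p z + g p z)"
    unfolding rational_in_def
  proof (intro exI conjI)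
    show "polyfun (Suc m) (\<lambda>x. P x * S x + R x * Q x)" "polyfun (Suc m) (\<lambda>x. Q x * S x)"
      by (intro polyfun.mult polyfun.add PQ RS)+
    show "\<forall>\<^sub>F z in cofinite_with z1. \<forall>p. (\<forall>i<m. \<not> pole_at u (p i)) \<longrightarrow>
        Q ((\<lambda>i. u (p i))(m := u z)) * S ((\<lambda>i. u (p i))(m := u z)) \<noteq> 0 \<longrightarrow>
        f p z + g p z = (P ((\<lambda>i. u (p i))(m := u z)) * S ((\<lambda>i. u (p i))(m := u z)) +
          R ((\<lambda>i. u (p i))(m := u z)) * Q ((\<lambda>i. u (p i))(m := u z))) /
          (Q ((\<lambda>i. u (p i))(m := u z)) * S ((\<lambda>i. u (p i))(m := u z)))"
      using f g by eventually_elim (simp add: add_frac_eq)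
  qed (fact w)
qed

lemma rational_in_sum:
  assumes "\<And>i. i \<in> I \<Longrightarrow> rational_in u z1 m (f i)"
  shows "rational_in u z1 m (\<lambda>p z. \<Sum>i\<in>I. f i p z)"
  using assms
  by (induction I rule: infinite_finite_induct) (auto intro: rational_in_const rational_in_add_mult)

lemma rational_in_prod:
  assumes "\<And>i. i \<in> I \<Longrightarrow> rational_in u z1 m (f i)"
  shows "rational_in u z1 m (\<lambda>p z. \<Prod>i\<in>I. f i p z)"
  using assms
  by (induction I rule: infinite_finite_induct) (auto intro: rational_in_const rational_in_add_mult)

lemma rational_in_sum_list:
  assumes "\<And>t. t \<in> set ts \<Longrightarrow> rational_in u z1 m (f t)"
  shows "rational_in u z1 m (\<lambda>p z. \<Sum>t\<leftarrow>ts. f t p z)"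
  using assms
  by (induction ts) (auto intro: rational_in_const rational_in_add_mult)

definition regular_coeff :: "(pline \<Rightarrow> complex) \<Rightarrow> pline \<Rightarrow> (pline \<Rightarrow> complex) \<Rightarrow> bool" where
  "regular_coeff u z1 c \<longleftrightarrow> (\<exists>p q. poly q (u z1) \<noteq> 0 \<and>
     (\<forall>\<^sub>F z in cofinite_with z1. poly q (u z) \<noteq> 0 \<longrightarrow> c z = poly p (u z) / poly q (u z)))"

text \<open>Quantifying over \<open>n\<close>, \<open>i\<close>, \<open>j\<close> expresses that
  \<open>P\<close> and \<open>Q\<close> are polynomials in two arguments, ready to be placed at any
  two positions; a component uses position \<open>i\<close> for the point of the form and
  \<open>m\<close> for the parameter. The denominator may vanish on the diagonal, only not
  identically over \<open>z1\<close>.\<close>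

definition regular_form :: "(pline \<Rightarrow> complex) \<Rightarrow> pline \<Rightarrow> (pline \<Rightarrow> form2) \<Rightarrow> bool" where
  "regular_form u z1 A \<longleftrightarrow> (\<exists>P Q.
     (\<forall>n i j. i < n \<longrightarrow> j < n \<longrightarrow> polyfun n (\<lambda>x. P (x i) (x j)) \<and> polyfun n (\<lambda>x. Q (x i) (x j))) \<and>
     (\<exists>y. Q y (u z1) \<noteq> 0) \<and>
     (\<forall>\<^sub>F z in cofinite_with z1. \<forall>x. \<not> pole_at u x \<longrightarrow> Q (u x) (u z) \<noteq> 0 \<longrightarrow>
        form_val (A z) x = P (u x) (u z) / Q (u x) (u z) * du u x))"

definition family_sum :: "((pline \<Rightarrow> complex) \<times> (pline \<Rightarrow> form2) list) list \<Rightarrow> pline \<Rightarrow> W" where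
  "family_sum ts z = (\<Sum>(c, L)\<leftarrow>ts. cst (c z) * prod_list (map (\<lambda>A. iota (A z)) L))"

text \<open>The number of terms and the length of each product do not depend on the point. Since
  \<open>has_component\<close> is existential over presentations, such a uniform presentation yields
  components that share one fraction.\<close>

definition regular_family :: "(pline \<Rightarrow> complex) \<Rightarrow> pline \<Rightarrow> (pline \<Rightarrow> W) \<Rightarrow> bool" where
  "regular_family u z1 N \<longleftrightarrow> (\<exists>ts.
     (\<forall>(c, L)\<in>set ts. regular_coeff u z1 c \<and> (\<forall>A\<in>set L. regular_form u z1 A)) \<and>
     (\<forall>\<^sub>F z in cofinite_with z1. N z = family_sum ts z))"

lemma regular_coeff_mult:
  assumes "regular_coeff u z1 c" "regular_coeff u z1 d"
  shows "regular_coeff u z1 (\<lambda>z. c z * d z)"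
proof -
  obtain p q where 1: "poly q (u z1) \<noteq> 0"
    "\<forall>\<^sub>F z in cofinite_with z1. poly q (u z) \<noteq> 0 \<longrightarrow> c z = poly p (u z) / poly q (u z)"
    using assms(1) unfolding regular_coeff_def by blast
  obtain r s where 2: "poly s (u z1) \<noteq> 0"
    "\<forall>\<^sub>F z in cofinite_with z1. poly s (u z) \<noteq> 0 \<longrightarrow> d z = poly r (u z) / poly s (u z)"
    using assms(2) unfolding regular_coeff_def by blast
  have "\<forall>\<^sub>F z in cofinite_with z1. poly (q * s) (u z) \<noteq> 0 \<longrightarrow>
      c z * d z = poly (p * r) (u z) / poly (q * s) (u z)"
    using 1(2) 2(2) by eventually_elim simp
  then show ?thesis
    unfolding regular_coeff_def using 1(1) 2(1) by (intro exI[of _ "p * r"] exI[of _ "q * s"]) simp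
qed

lemma regular_coeff_const: "regular_coeff u z1 (\<lambda>_. c)"
  unfolding regular_coeff_def by (intro exI[of _ "[:c:]"] exI[of _ 1]) simp

lemma regular_family_add:
  assumes "regular_family u z1 M" "regular_family u z1 N"
  shows "regular_family u z1 (\<lambda>z. M z + N z)"
proof -
  obtain ts ss where
    "\<forall>(c, L)\<in>set ts. regular_coeff u z1 c \<and> (\<forall>A\<in>set L. regular_form u z1 A)"
    "\<forall>(c, L)\<in>set ss. regular_coeff u z1 c \<and> (\<forall>A\<in>set L. regular_form u z1 A)"
    and ev: "\<forall>\<^sub>F z in cofinite_with z1. M z = family_sum ts z"
      "\<forall>\<^sub>F z in cofinite_with z1. N z = family_sum ss z"
    using assms unfolding regular_family_def by blast
  then have "\<forall>(c, L)\<in>set (ts @ ss). regular_coeff u z1 c \<and> (\<forall>A\<in>set L. regular_form u z1 A)"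
    by auto
  moreover have "\<forall>\<^sub>F z in cofinite_with z1. M z + N z = family_sum (ts @ ss) z"
    using ev by eventually_elim (simp add: family_sum_def)
  ultimately show ?thesis unfolding regular_family_def by blast
qed

lemma regular_family_cong:
  assumes "regular_family u z1 M" "\<forall>\<^sub>F z in cofinite_with z1. M z = N z"
  shows "regular_family u z1 N"
proof -
  obtain ts where ts: "\<forall>(c, L)\<in>set ts. regular_coeff u z1 c \<and> (\<forall>A\<in>set L. regular_form u z1 A)"
    and ev: "\<forall>\<^sub>F z in cofinite_with z1. M z = family_sum ts z"
    using assms(1) unfolding regular_family_def by blast
  have "\<forall>\<^sub>F z in cofinite_with z1. N z = family_sum ts z"
    using ev assms(2) by eventually_elim simp
  with ts show ?thesis unfolding regular_family_def by blast
qed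

lemma regular_family_monomial_mult:
  assumes "regular_coeff u z1 c" "\<forall>A\<in>set L. regular_form u z1 A" "regular_family u z1 N"
  shows "regular_family u z1 (\<lambda>z. cst (c z) * prod_list (map (\<lambda>A. iota (A z)) L) * N z)"
proof -
  obtain ts where ts: "\<forall>(c, L)\<in>set ts. regular_coeff u z1 c \<and> (\<forall>A\<in>set L. regular_form u z1 A)"
    and ev: "\<forall>\<^sub>F z in cofinite_with z1. N z = family_sum ts z"
    using assms(3) unfolding regular_family_def by blast
  define ss where "ss = map (\<lambda>(d, K). (\<lambda>z. c z * d z, L @ K)) ts"
  have mono: "cst (c z) * prod_list (map (\<lambda>A. iota (A z)) L) * family_sum ts z = family_sum ss z" for z
    unfolding ss_def family_sum_def
    by (induction ts) (auto simp: cst_mult distrib_left mult_ac)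
  have "\<forall>(c, L)\<in>set ss. regular_coeff u z1 c \<and> (\<forall>A\<in>set L. regular_form u z1 A)"
    using ts assms(1,2) unfolding ss_def by (fastforce intro: regular_coeff_mult)
  moreover have "\<forall>\<^sub>F z in cofinite_with z1.
      cst (c z) * prod_list (map (\<lambda>A. iota (A z)) L) * N z = family_sum ss z"
    using ev by eventually_elim (simp add: mono)
  ultimately show ?thesis unfolding regular_family_def by blast
qed

lemma regular_family_cst:
  assumes "regular_coeff u z1 c"
  shows "regular_family u z1 (\<lambda>z. cst (c z))"
  unfolding regular_family_def
  by (intro exI[of _ "[(c, [])]"]) (simp add: assms family_sum_def)

lemma regular_family_iota:
  assumes "regular_form u z1 A"
  shows "regular_family u z1 (\<lambda>z. iota (A z))"
  unfolding regular_family_def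
  by (intro exI[of _ "[(\<lambda>_. 1, [A])]"]) (simp add: assms family_sum_def regular_coeff_const)

lemma regular_family_mult:
  assumes "regular_family u z1 M" "regular_family u z1 N"
  shows "regular_family u z1 (\<lambda>z. M z * N z)"
proof -
  obtain ts where ts: "\<forall>(c, L)\<in>set ts. regular_coeff u z1 c \<and> (\<forall>A\<in>set L. regular_form u z1 A)"
    and ev: "\<forall>\<^sub>F z in cofinite_with z1. M z = family_sum ts z"
    using assms(1) unfolding regular_family_def by blast
  have "regular_family u z1 (\<lambda>z. family_sum ts z * N z)"
    using ts
  proof (induction ts)
    case Nil
    show ?case
      using regular_family_cst[OF regular_coeff_const[of u z1 0]] by (simp add: family_sum_def)
  next
    case (Cons t ts)
    obtain c L where t: "t = (c, L)" by (cases t)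
    have "regular_family u z1 (\<lambda>z. cst (c z) * prod_list (map (\<lambda>A. iota (A z)) L) * N z + family_sum ts z * N z)"
      using Cons t by (intro regular_family_add regular_family_monomial_mult assms(2)) auto
    then show ?case by (simp add: family_sum_def t distrib_right)
  qed
  then show ?thesis
    by (rule regular_family_cong) (use ev in eventually_elim, simp)
qed

lemma rational_in_coeff:
  assumes "regular_coeff u z1 c"
  shows "rational_in u z1 m (\<lambda>p z. c z)"
proof -
  obtain p q where q: "poly q (u z1) \<noteq> 0"
    and ev: "\<forall>\<^sub>F z in cofinite_with z1. poly q (u z) \<noteq> 0 \<longrightarrow> c z = poly p (u z) / poly q (u z)"
    using assms unfolding regular_coeff_def by blast
  show ?thesis
    unfolding rational_in_def
  proof (intro exI conjI)
    show "polyfun (Suc m) (\<lambda>x. poly p (x m))" "polyfun (Suc m) (\<lambda>x. poly q (x m))"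
      by (simp_all add: polyfun_poly)
    show "poly q (((\<lambda>_. 0)(m := u z1)) m) \<noteq> 0" using q by simp
    show "\<forall>\<^sub>F z in cofinite_with z1. \<forall>pt. (\<forall>i<m. \<not> pole_at u (pt i)) \<longrightarrow>
        poly q (((\<lambda>i. u (pt i))(m := u z)) m) \<noteq> 0 \<longrightarrow>
        c z = poly p (((\<lambda>i. u (pt i))(m := u z)) m) / poly q (((\<lambda>i. u (pt i))(m := u z)) m)"
      using ev by eventually_elim simp
  qed
qed

lemma rational_in_form:
  assumes u: "coordinate u" and A: "regular_form u z1 A" and i: "i < m"
  shows "rational_in u z1 m (\<lambda>p z. form_val (A z) (p i) / du u (p i))"
proof -
  obtain P Q y where poly: "\<And>n i j. i < n \<Longrightarrow> j < n \<Longrightarrow> polyfun n (\<lambda>x. P (x i) (x j))"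
      "\<And>n i j. i < n \<Longrightarrow> j < n \<Longrightarrow> polyfun n (\<lambda>x. Q (x i) (x j))"
    and y: "Q y (u z1) \<noteq> 0"
    and ev: "\<forall>\<^sub>F z in cofinite_with z1. \<forall>x. \<not> pole_at u x \<longrightarrow> Q (u x) (u z) \<noteq> 0 \<longrightarrow>
        form_val (A z) x = P (u x) (u z) / Q (u x) (u z) * du u x"
    using A unfolding regular_form_def by blast
  show ?thesis
    unfolding rational_in_def
  proof (intro exI conjI)
    show "polyfun (Suc m) (\<lambda>x. P (x i) (x m))" "polyfun (Suc m) (\<lambda>x. Q (x i) (x m))"
      using i by (simp_all add: poly)
    show "Q (((\<lambda>_. y)(m := u z1)) i) (((\<lambda>_. y)(m := u z1)) m) \<noteq> 0" using y i by simp
    show "\<forall>\<^sub>F z in cofinite_with z1. \<forall>p. (\<forall>i<m. \<not> pole_at u (p i)) \<longrightarrow>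
        Q (((\<lambda>i. u (p i))(m := u z)) i) (((\<lambda>i. u (p i))(m := u z)) m) \<noteq> 0 \<longrightarrow>
        form_val (A z) (p i) / du u (p i) = P (((\<lambda>i. u (p i))(m := u z)) i) (((\<lambda>i. u (p i))(m := u z)) m)
          / Q (((\<lambda>i. u (p i))(m := u z)) i) (((\<lambda>i. u (p i))(m := u z)) m)"
      using ev by eventually_elim (use i du_nonzero[OF u] in simp)
  qed
qed

text \<open>The filter supplies the component at \<open>z1\<close> by the same fraction, so the
  limit is obtained by evaluation. \<open>F\<close> may differ from \<open>N\<close> at finitely
  many points, in particular at \<open>z1\<close>, because the exceptional set of the limit absorbs
  them.\<close>

lemma W_tendsto_regular_family:
  assumes u: "coordinate u" and N: "regular_family u z1 N"
    and F: "finite {z. F z \<noteq> N z}"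
  shows "W_tendsto u z1 F (N z1)"
  unfolding W_tendsto_def
proof
  fix m
  obtain ts where ts: "\<And>c L. (c, L) \<in> set ts \<Longrightarrow> regular_coeff u z1 c"
      "\<And>c L A. (c, L) \<in> set ts \<Longrightarrow> A \<in> set L \<Longrightarrow> regular_form u z1 A"
    and ev: "\<forall>\<^sub>F z in cofinite_with z1. N z = family_sum ts z"
    using N unfolding regular_family_def by fast
  define fs where "fs = filter (\<lambda>(c, L). length L = m) ts"
  \<comment> \<open>Each value of a form is divided by \<open>du\<close> at its point;
    \<open>component_is\<close> restores these factors as the product of the differentials.\<close>
  define f where "f = (\<lambda>(c, L) p (z :: pline). c z * (\<Sum>\<sigma> | \<sigma> permutes {..<m}.
      \<Prod>i<m. form_val ((L ! \<sigma> i) z) (p i) / du u (p i)) :: complex)"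
  have "rational_in u z1 m (\<lambda>p z. \<Sum>t\<leftarrow>fs. f t p z)"
  proof (rule rational_in_sum_list)
    fix t assume t: "t \<in> set fs"
    then obtain c L where cL: "t = (c, L)" "(c, L) \<in> set ts" "length L = m"
      unfolding fs_def by auto
    have "regular_form u z1 (L ! \<sigma> i)" if "\<sigma> permutes {..<m}" "i < m" for \<sigma> i
      using ts(2)[OF cL(2)] cL(3) permutes_in_image[OF that(1), of i] that(2) by simp
    then show "rational_in u z1 m (f t)"
      unfolding f_def cL prod.case
      by (intro rational_in_add_mult(2) rational_in_sum rational_in_prod rational_in_coeff
          rational_in_form u ts(1)[OF cL(2)]) auto
  qed
  then obtain P Q where PQ: "polyfun (Suc m) P" "polyfun (Suc m) Q"
    "\<exists>x. Q (x(m := u z1)) \<noteq> 0"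
    and ev2: "\<forall>\<^sub>F z in cofinite_with z1. \<forall>p. (\<forall>i<m. \<not> pole_at u (p i)) \<longrightarrow>
        Q ((\<lambda>i. u (p i))(m := u z)) \<noteq> 0 \<longrightarrow>
        (\<Sum>t\<leftarrow>fs. f t p z) = P ((\<lambda>i. u (p i))(m := u z)) / Q ((\<lambda>i. u (p i))(m := u z))"
    unfolding rational_in_def by blast
  have "\<forall>\<^sub>F z in cofinite_with z1. component_is u m (N z) (\<lambda>x. P (x(m := u z))) (\<lambda>x. Q (x(m := u z)))"
    using ev ev2
  proof eventually_elim
    case (elim z)
    define ss where "ss = map (\<lambda>(c, L). (c z, map (\<lambda>A. A z) L)) ts"
    define \<Phi> where "\<Phi> = (\<lambda>p. \<Sum>(c, L)\<leftarrow>filter (\<lambda>(c, L). length L = m) ss. c * sym_polydiff L p)"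
    have "N z = (\<Sum>(c, L)\<leftarrow>ss. cst c * prod_list (map iota L))"
      unfolding elim(1) family_sum_def ss_def by (simp add: o_def case_prod_unfold)
    then have "has_component m (N z) \<Phi>"
      unfolding has_component_def \<Phi>_def by blast
    moreover have "\<Phi> p = P ((\<lambda>i. u (p i))(m := u z)) / Q ((\<lambda>i. u (p i))(m := u z)) * (\<Prod>i<m. du u (p i))"
      if p: "\<forall>i<m. \<not> pole_at u (p i)" and Q: "Q ((\<lambda>i. u (p i))(m := u z)) \<noteq> 0" for p
    proof -
      have term_eq: "c z * sym_polydiff (map (\<lambda>A. A z) L) p = f (c, L) p z * (\<Prod>i<m. du u (p i))"
        if L: "length L = m" for c L
      proof -
        have "(\<Prod>i<m. form_val (map (\<lambda>A. A z) L ! \<sigma> i) (p i)) =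
            (\<Prod>i<m. form_val ((L ! \<sigma> i) z) (p i) / du u (p i)) * (\<Prod>i<m. du u (p i))"
          if "\<sigma> permutes {..<m}" for \<sigma>
          unfolding prod.distrib[symmetric]
        proof (rule prod.cong)
          fix i assume "i \<in> {..<m}"
          moreover from this have "\<sigma> i < m" using permutes_in_image[OF that, of i] by simp
          ultimately show "form_val (map (\<lambda>A. A z) L ! \<sigma> i) (p i) =
              form_val ((L ! \<sigma> i) z) (p i) / du u (p i) * du u (p i)"
            using L p du_nonzero[OF u] by simp
        qed simp
        then show ?thesis
          unfolding sym_polydiff_def f_def by (simp add: L sum_distrib_right mult.assoc)
      qed
      have "\<Phi> p = (\<Sum>(c, L)\<leftarrow>fs. c z * sym_polydiff (map (\<lambda>A. A z) L) p)"
        unfolding \<Phi>_def ss_def fs_def by (simp add: filter_map o_def case_prod_unfold)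
      also have "\<dots> = (\<Sum>t\<leftarrow>fs. f t p z * (\<Prod>i<m. du u (p i)))"
        by (intro arg_cong[of _ _ sum_list] map_cong refl) (auto simp: fs_def term_eq)
      also have "\<dots> = (\<Sum>t\<leftarrow>fs. f t p z) * (\<Prod>i<m. du u (p i))"
        by (simp add: sum_list_mult_const)
      finally show ?thesis using elim(2) p Q by simp
    qed
    ultimately show ?case unfolding component_is_def by blast
  qed
  then have fin: "finite {z. \<not> component_is u m (N z) (\<lambda>x. P (x(m := u z))) (\<lambda>x. Q (x(m := u z)))}"
    and z1: "component_is u m (N z1) (\<lambda>x. P (x(m := u z1))) (\<lambda>x. Q (x(m := u z1)))"
    unfolding eventually_cofinite_with by blast+
  define Z where "Z = {z. F z \<noteq> N z} \<union>
    {z. \<not> component_is u m (N z) (\<lambda>x. P (x(m := u z))) (\<lambda>x. Q (x(m := u z)))}"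
  have "finite Z" using F fin unfolding Z_def by blast
  moreover have "component_is u m (F z) (\<lambda>x. P (x(m := u z))) (\<lambda>x. Q (x(m := u z)))" if "z \<notin> Z" for z
    using that unfolding Z_def by simp
  ultimately show "\<exists>P Q. polyfun (Suc m) P \<and> polyfun (Suc m) Q \<and>
     (\<exists>x. Q (x(m := u z1)) \<noteq> 0) \<and>
     (\<exists>Z. finite Z \<and> (\<forall>z2. z2 \<notin> Z \<longrightarrow>
        component_is u m (F z2) (\<lambda>x. P (x(m := u z2))) (\<lambda>x. Q (x(m := u z2))))) \<and>
     component_is u m (N z1) (\<lambda>x. P (x(m := u z1))) (\<lambda>x. Q (x(m := u z1)))"
    using PQ z1 by blast
qed

subsection \<open>Regularity of the fields\<close>

context
  fixes u :: "pline \<Rightarrow> complex" and z1 :: pline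
  assumes u: "coordinate u" and z1: "\<not> pole_at u z1"
begin

lemma eventually_not_pole_at: "\<forall>\<^sub>F z in cofinite_with z1. \<not> pole_at u z"
  using finite_pole_at[OF u] z1 by (simp add: eventually_cofinite_with)

lemma regular_form_const: "regular_form u z1 (\<lambda>_. \<alpha>)"
proof (rule form_rational[OF u, of \<alpha>])
  fix p q :: "complex poly"
  assume q: "q \<noteq> 0"
    "\<And>x. \<not> pole_at u x \<Longrightarrow> poly q (u x) \<noteq> 0 \<Longrightarrow> form_val \<alpha> x = poly p (u x) / poly q (u x) * du u x"
  obtain y where "poly q y \<noteq> 0" using q(1) poly_all_0_iff_0 by blast
  then show ?thesis
    unfolding regular_form_def
    by (intro exI[of _ "\<lambda>y s. poly p y"] exI[of _ "\<lambda>y s. poly q y"] conjI exI[of _ y])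
      (use q in \<open>simp_all add: polyfun_poly\<close>)
qed

lemma regular_form_bidiff_form: "regular_form u z1 (\<lambda>z. bidiff_form (- 1 / du u z) z)"
  unfolding regular_form_def
proof (intro exI conjI)
  show "\<forall>n i j. i < n \<longrightarrow> j < n \<longrightarrow>
      polyfun n (\<lambda>x. - 1) \<and> polyfun n (\<lambda>x. (x i + (- 1) * x j) * (x i + (- 1) * x j))"
    by (intro allI impI conjI polyfun.intros)
  \<comment> \<open>The denominator vanishes only on the diagonal, so any first argument other than
    \<open>u z1\<close> is a witness.\<close>
  show "(u z1 + 1 + (- 1) * u z1) * (u z1 + 1 + (- 1) * u z1) \<noteq> 0" by simp
  show "\<forall>\<^sub>F z in cofinite_with z1. \<forall>x. \<not> pole_at u x \<longrightarrow>
      (u x + (- 1) * u z) * (u x + (- 1) * u z) \<noteq> 0 \<longrightarrow>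
      form_val (bidiff_form (- 1 / du u z) z) x = - 1 / ((u x + (- 1) * u z) * (u x + (- 1) * u z)) * du u x"
    using eventually_not_pole_at
  proof eventually_elim
    case (elim z)
    show ?case
    proof (intro allI impI)
      fix x assume x: "\<not> pole_at u x" and "(u x + (- 1) * u z) * (u x + (- 1) * u z) \<noteq> 0"
      then have "x \<noteq> z" by auto
      then have "bidiff x z = du u x * du u z / (u x - u z)\<^sup>2"
        using coordinate_bidiff[OF u x elim] by simp
      then show "form_val (bidiff_form (- 1 / du u z) z) x =
          - 1 / ((u x + (- 1) * u z) * (u x + (- 1) * u z)) * du u x"
        using du_nonzero[OF u elim] by (simp add: form_val_bidiff_form power2_eq_square)
    qed
  qed
qed

lemma regular_family_const: "v \<in> W_at z1 \<Longrightarrow> regular_family u z1 (\<lambda>_. v)"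
proof (induction rule: W_at.induct)
  case (cst c)
  show ?case by (rule regular_family_cst[OF regular_coeff_const])
next
  case (iota \<alpha>)
  show ?case by (rule regular_family_iota[OF regular_form_const])
next
  case (add x y)
  then show ?case by (intro regular_family_add)
next
  case (mult x y)
  then show ?case by (intro regular_family_mult)
qed

text \<open>Where \<open>q\<close> does not vanish the constant term is the value of the form, and
  division by \<open>du u z\<close> leaves \<open>p / q\<close> up to sign. Regularity at
  \<open>z1\<close> says precisely that \<open>q\<close> is nonzero at \<open>u z1\<close>.\<close>

lemma regular_coeff_form_val:
  assumes "form_regular \<alpha> z1"
  shows "regular_coeff u z1 (\<lambda>z. 1 / du u z * - const_term z \<alpha>)"
proof (rule form_rational[OF u, of \<alpha>])
  fix p q :: "complex poly"
  assume q: "\<And>x. \<not> pole_at u x \<Longrightarrow> form_regular \<alpha> x \<longleftrightarrow> poly q (u x) \<noteq> 0"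
    and pq: "\<And>x. \<not> pole_at u x \<Longrightarrow> poly q (u x) \<noteq> 0 \<Longrightarrow>
      form_val \<alpha> x = poly p (u x) / poly q (u x) * du u x"
  have "\<forall>\<^sub>F z in cofinite_with z1. poly q (u z) \<noteq> 0 \<longrightarrow>
      1 / du u z * - const_term z \<alpha> = poly (- p) (u z) / poly q (u z)"
    using eventually_not_pole_at
    by eventually_elim (simp add: q[symmetric] const_term_regular, simp add: q pq du_nonzero[OF u])
  then show ?thesis
    unfolding regular_coeff_def using q[OF z1] assms by blast
qed

text \<open>The factor \<open>1 / du u z\<close> passes from the frame of the chart, which changes
  at infinity, to the frame given by \<open>u\<close>. The Leibniz rule then reduces the claim to
  generators.\<close>

lemma regular_family_deriv:
  "v \<in> W_at z1 \<Longrightarrow> regular_family u z1 (\<lambda>z. cst (1 / du u z) * W_deriv z v)"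
proof (induction rule: W_at.induct)
  case (cst c)
  show ?case using regular_family_cst[OF regular_coeff_const[of u z1 0]] by simp
next
  case (iota \<alpha>)
  show ?case
    using regular_family_cst[OF regular_coeff_form_val[OF iota]]
    by (simp only: W_deriv_iota cst_mult)
next
  case (add x y)
  then show ?case
    unfolding W_deriv_add distrib_left by (intro regular_family_add)
next
  case (mult x y)
  have "regular_family u z1 (\<lambda>z. cst (1 / du u z) * W_deriv z x * y + x * (cst (1 / du u z) * W_deriv z y))"
    by (intro regular_family_add regular_family_mult[OF mult.IH(1)] regular_family_mult[OF _ mult.IH(2)]
        regular_family_const mult.hyps)
  then show ?case by (simp add: W_deriv_mult distrib_left mult_ac)
qed

end

section \<open>Normal ordering and the limit\<close>

lemma cst_numeral_2: "cst 2 = 2"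
  using cst_add[of 1 1] by simp

lemma T_field_eq:
  assumes "v \<in> W_at z"
  shows "T_field z v = cst (1 / 2) * (W_deriv z (W_deriv z v) + iota (e_form z) * (iota (e_form z) * v)
    + 2 * (iota (e_form z) * W_deriv z v))"
  using assms by (simp add: T_field_def i_field_eq e_field_def W_deriv_in_W_at)

text \<open>Ensures that \<open>b_field z2\<close> acts on \<open>T_field z1 v\<close> through the
  derivation and not through the default value outside its domain.\<close>

lemma T_field_in_W_at:
  assumes "v \<in> W_at z1" "v \<in> W_at z2" "z2 \<noteq> z1"
  shows "T_field z1 v \<in> W_at z2"
proof -
  have "(2 :: W) \<in> W_at z2" using W_at.cst[of 2] by (simp add: cst_numeral_2)
  then show ?thesis
    unfolding T_field_eq[OF assms(1)]
    by (intro W_at.mult W_at.add W_at.cst W_deriv_in_W_at iota_e_form_in_W_at assms)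
qed

lemma normal_order_b_T:
  assumes v: "v \<in> W_at z1" "v \<in> W_at z2" and ne: "z2 \<noteq> z1"
  defines "e1 \<equiv> iota (e_form z1)" and "e2 \<equiv> iota (e_form z2)"
    and "D1 \<equiv> W_deriv z1" and "D2 \<equiv> W_deriv z2"
  shows "2 * b_field z2 (T_field z1 v) - 2 * cst (omega z2 z1) * b_field z1 v =
    e2 * (e1 * (e1 * v)) + 2 * (e2 * (e1 * D1 v)) + e2 * D1 (D1 v)
    + e1 * (e1 * D2 v) + 2 * (e1 * D2 (D1 v)) + D2 (D1 (D1 v))"
proof -
  define h where "h = cst (1 / 2)"
  define w where "w = cst (omega z2 z1)"
  have h: "2 * (h * x) = x" for x
    using cst_mult[of 2 "1 / 2"] by (simp add: h_def cst_numeral_2 mult.assoc[symmetric])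
  \<comment> \<open>As a sum, the factor is handled by additivity of \<open>D2\<close>
    alone.\<close>
  have two: "2 * x = x + x" for x :: W by simp
  have D2e1: "D2 e1 = w" unfolding D2_def e1_def w_def by (rule W_deriv_e_form[OF ne])
  have D2h: "D2 h = 0" by (simp add: D2_def h_def)
  have D2_add: "D2 (x + y) = D2 x + D2 y" and D2_mult: "D2 (x * y) = D2 x * y + x * D2 y" for x y
    by (simp_all add: D2_def W_deriv_add W_deriv_mult)
  define X where "X = D1 (D1 v) + e1 * (e1 * v) + 2 * (e1 * D1 v)"
  have T: "T_field z1 v = h * X"
    unfolding T_field_eq[OF v(1)] X_def h_def e1_def D1_def ..
  have "2 * b_field z2 (T_field z1 v) = 2 * D2 (h * X) + 2 * (e2 * (h * X))"
    using T_field_in_W_at[OF v ne]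
    by (simp add: b_field_def i_field_eq e_field_def T D2_def e2_def distrib_left)
  also have "\<dots> = D2 X + e2 * X"
    by (simp only: D2_mult D2h mult_zero_left add_0_left h mult.left_commute[of e2])
  finally have "2 * b_field z2 (T_field z1 v) = D2 X + e2 * X" .
  moreover have "b_field z1 v = D1 v + e1 * v"
    using v(1) by (simp add: b_field_def i_field_eq e_field_def D1_def e1_def)
  \<comment> \<open>The terms with \<open>w\<close> are two from the Leibniz rule on
    \<open>e1 * (e1 * v)\<close> and a doubled one from \<open>e1 * D1 v\<close>. Together they are
    \<open>2 * w * (e1 * v + D1 v)\<close>, which the subtraction removes.\<close>
  moreover have "D2 X = D2 (D1 (D1 v)) + (w * (e1 * v) + e1 * (w * v + e1 * D2 v))
      + 2 * (w * D1 v + e1 * D2 (D1 v))"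
    unfolding X_def two D2_add D2_mult D2e1 ..
  ultimately show ?thesis
    unfolding w_def[symmetric] X_def by (simp add: algebra_simps)
qed

text \<open>The scalar factors trivialise the fibres, one \<open>du\<close> for \<open>b\<close> and
  two for \<open>T\<close>. The finiteness claim guarantees that the default value of
  \<open>i_field\<close> does not enter at almost all \<open>z2\<close>.\<close>

theorem proposition4p2:
  fixes z1 :: pline and v :: W
  assumes "v \<in> W_at z1"
  shows "finite {z2. z2 \<noteq> z1 \<and> T_field z1 v \<notin> W_at z2} \<and>
    (\<forall>u. coordinate u \<and> \<not> pole_at u z1 \<longrightarrow>
      W_tendsto u z1
        (\<lambda>z2. cst (1 / (du u z2 * (du u z1)\<^sup>2)) *
           (2 * b_field z2 (T_field z1 v) - 2 * cst (omega z2 z1) * b_field z1 v))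
        (cst (1 / (du u z1) ^ 3) * S_field z1 v))"
proof (intro conjI allI impI)
  show "finite {z2. z2 \<noteq> z1 \<and> T_field z1 v \<notin> W_at z2}"
    by (rule finite_subset[OF _ finite_not_in_W_at[OF assms]]) (use T_field_in_W_at[OF assms] in auto)
next
  fix u assume "coordinate u \<and> \<not> pole_at u z1"
  then have u: "coordinate u" and z1: "\<not> pole_at u z1" by auto
  define k where "k = cst (1 / (du u z1)\<^sup>2)"
  define e1 where "e1 = iota (e_form z1)"
  define E where "E = (\<lambda>z. iota (bidiff_form (- 1 / du u z) z))"
  define I where "I = (\<lambda>z x. cst (1 / du u z) * W_deriv z x)"
  define D where "D = W_deriv z1"
  \<comment> \<open>The normally ordered expression with each \<open>e\<close> and \<open>i\<close>
    at \<open>z\<close> divided by \<open>du u z\<close>, while \<open>k\<close> carries the two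
    factors at \<open>z1\<close>. Unlike the original expression it has the intended value at
    \<open>z = z1\<close> as well.\<close>
  define N where "N = (\<lambda>z. k * (E z * (e1 * (e1 * v)) + 2 * (E z * (e1 * D v)) + E z * D (D v)
      + e1 * (e1 * I z v) + 2 * (e1 * I z (D v)) + I z (D (D v))))"
  have E: "E z = cst (1 / du u z) * iota (e_form z)" for z
    using iota_bidiff_form[of "1 / du u z" "- 1" z] by (simp add: E_def e_form_eq)
  have Dv: "D v \<in> W_at z1" "D (D v) \<in> W_at z1"
    unfolding D_def by (intro W_deriv_in_W_at assms)+
  have two: "(2 :: W) \<in> W_at z1" using W_at.cst[of 2] by (simp add: cst_numeral_2)
  have "k \<in> W_at z1" unfolding k_def by (rule W_at.cst)
  note reg = regular_family_const[OF u z1]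
  \<comment> \<open>\<open>e_form z1\<close> has a pole at \<open>z1\<close>, so \<open>reg\<close>
    does not apply. A constant form may have poles there, since they concern only the auxiliary
    points.\<close>
  have "regular_family u z1 (\<lambda>_. e1)"
    unfolding e1_def by (intro regular_family_iota regular_form_const[OF u z1])
  moreover have "regular_family u z1 E"
    unfolding E_def by (intro regular_family_iota regular_form_bidiff_form[OF u z1])
  moreover have "regular_family u z1 (\<lambda>z. I z x)" if "x \<in> W_at z1" for x
    unfolding I_def by (rule regular_family_deriv[OF u z1 that])
  ultimately have "regular_family u z1 N"
    unfolding N_def
    by (intro regular_family_mult regular_family_add)
      (use reg[OF assms] reg[OF Dv(1)] reg[OF Dv(2)] reg[OF two] reg[OF \<open>k \<in> W_at z1\<close>] assms Dv in blast)+
  moreover have "finite {z. cst (1 / (du u z * (du u z1)\<^sup>2)) *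
      (2 * b_field z (T_field z1 v) - 2 * cst (omega z z1) * b_field z1 v) \<noteq> N z}"
  proof (rule finite_subset)
    \<comment> \<open>Normal ordering requires \<open>z \<noteq> z1\<close> and \<open>v\<close> to
      lie in the domain at \<open>z\<close>; elsewhere the two sides may differ.\<close>
    show "finite ({z1} \<union> {z. v \<notin> W_at z})" using finite_not_in_W_at[OF assms] by simp
    have "cst (1 / (du u z * (du u z1)\<^sup>2)) *
        (2 * b_field z (T_field z1 v) - 2 * cst (omega z z1) * b_field z1 v) = N z"
      if "z \<noteq> z1" "v \<in> W_at z" for z
    proof -
      have "cst (1 / (du u z * (du u z1)\<^sup>2)) = k * cst (1 / du u z)"
        by (simp add: k_def mult.commute flip: cst_mult)
      then show ?thesis
        unfolding normal_order_b_T[OF assms that(2,1)] N_def E I_def D_def e1_def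
        by (simp add: algebra_simps)
    qed
    then show "{z. cst (1 / (du u z * (du u z1)\<^sup>2)) *
        (2 * b_field z (T_field z1 v) - 2 * cst (omega z z1) * b_field z1 v) \<noteq> N z} \<subseteq> {z1} \<union> {z. v \<notin> W_at z}"
      by blast
  qed
  ultimately have "W_tendsto u z1 (\<lambda>z. cst (1 / (du u z * (du u z1)\<^sup>2)) *
      (2 * b_field z (T_field z1 v) - 2 * cst (omega z z1) * b_field z1 v)) (N z1)"
    by (rule W_tendsto_regular_family[OF u])
  \<comment> \<open>For equal points the mixed terms merge in pairs with \<open>2 + 1 = 3\<close>,
    which gives the binomial coefficients of \<open>S_field\<close>.\<close>
  moreover have "N z1 = cst (1 / (du u z1) ^ 3) * S_field z1 v"
  proof -
    have "cst (1 / (du u z1) ^ 3) = k * cst (1 / du u z1)"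
      by (simp add: k_def power3_eq_cube power2_eq_square flip: cst_mult)
    moreover have "S_field z1 v = e1 * (e1 * (e1 * v)) + 3 * (e1 * (e1 * D v)) + 3 * (e1 * D (D v)) + D (D (D v))"
      using assms Dv by (simp add: S_field_def e_field_def i_field_eq e1_def D_def)
    ultimately show ?thesis
      unfolding N_def E I_def D_def[symmetric] e1_def[symmetric] by (simp add: algebra_simps)
  qed
  ultimately show "W_tendsto u z1 (\<lambda>z2. cst (1 / (du u z2 * (du u z1)\<^sup>2)) *
      (2 * b_field z2 (T_field z1 v) - 2 * cst (omega z2 z1) * b_field z1 v))
      (cst (1 / (du u z1) ^ 3) * S_field z1 v)" by simp
qed

end
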